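(* Let $d\ge 3$. There exists a non-increasing function $K(\beta)$ of $\beta>0$ such that for all $n\ge 1$, all $\beta>0$ and any $D\in\mathcal{D}_1$, $$\mathrm{Var}(N(D))\le K(\beta)\max\{\log^{12}(n),1\}.$$ Moreover, the same bound holds for $\mathrm{Var}(N(D))$ for any dyadic cube $D\in\mathcal{D}$.
   Context: Dyadic cubes: for $k\ge 0$, $\mathcal{D}_k$ is the set of all cubes $\prod_{l=1}^d\left[\frac{i_l}{2^k},\frac{i_l+1}{2^k}\right)$ with $0\le i_1,\dots,i_d\le 2^k-1$, and $\mathcal{D}=\bigcup_{k\ge0}\mathcal{D}_k$. For distinct points $x,y\in[0,1)^d$ set $w(x,y)=2^{(d-2)(k-1)}$, where $k$ is the smallest integer such that $x$ and $y$ do not belong to the same cube of $\mathcal{D}_k$. For $\mathbf{x}=(x_1,\dots,x_n)\in([0,1)^d)^n$ let $H_n(\mathbf{x})=\sum_{i\ne j}w(x_i,x_j)$ (sum over ordered pairs). The hierarchical Coulomb gas of size $n$ at inverse temperature $\beta>0$ is the random vector $(X_1,\dots,X_n)$ in $([0,1)^d)^n$ with density $\frac1{Z(n,\beta)}\exp(-\beta H_n(\mathbf{x}))$ with respect to Lebesgue measure, where $Z(n,\beta)$ is the normalizing constant. $N(D)$ denotes the number of indices $i\le n$ with $X_i\in D$, and $\mathrm{Var}$ is the variance under this measure. The dimension $d$ is fixed, and $K$ may depend on it. *)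

theory Defs
  imports "HOL-Probability.Probability"
begin

definition unit_cube :: "(real ^ 'd) set" where
  "unit_cube = {x. \<forall>l. 0 \<le> x $ l \<and> x $ l < 1}"

definition dyadic_cube :: "nat \<Rightarrow> ('d \<Rightarrow> nat) \<Rightarrow> (real ^ 'd) set" where
  "dyadic_cube k i = {x. \<forall>l. real (i l) / 2 ^ k \<le> x $ l \<and> x $ l < (real (i l) + 1) / 2 ^ k}"

definition dyadic_cubes_level :: "nat \<Rightarrow> (real ^ 'd) set set" where
  "dyadic_cubes_level k = {dyadic_cube k i | i. \<forall>l. i l \<le> 2 ^ k - 1}"

definition dyadic_cubes :: "(real ^ 'd) set set" where
  "dyadic_cubes = (\<Union>k. dyadic_cubes_level k)"

definition same_dyadic_cube :: "nat \<Rightarrow> real ^ 'd \<Rightarrow> real ^ 'd \<Rightarrow> bool" where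
  "same_dyadic_cube k x y \<longleftrightarrow> (\<exists>D\<in>dyadic_cubes_level k. x \<in> D \<and> y \<in> D)"

definition separation_level :: "real ^ 'd \<Rightarrow> real ^ 'd \<Rightarrow> nat" where
  "separation_level x y = (LEAST k. \<not> same_dyadic_cube k x y)"

text \<open>The interaction is only meaningful for distinct points of the unit cube, where the separation
  level is at least 1, so that the second natural subtraction is exact; the first one is exact in
  dimension at least 2. The value 0 on the diagonal is a convention; configurations with coinciding
  points form a Lebesgue null set.\<close>

definition interaction :: "real ^ 'd \<Rightarrow> real ^ 'd \<Rightarrow> real" where
  "interaction x y =
     (if x = y then 0 else 2 ^ ((CARD('d) - 2) * (separation_level x y - 1)))"

text \<open>A configuration of \<open>n\<close> points is a function whose values at the indices below \<open>n\<close> are the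
  points.\<close>

definition energy :: "nat \<Rightarrow> (nat \<Rightarrow> real ^ 'd) \<Rightarrow> real" where
  "energy n x = (\<Sum>i<n. \<Sum>j\<in>{..<n} - {i}. interaction (x i) (x j))"

definition cube_lebesgue :: "nat \<Rightarrow> (nat \<Rightarrow> real ^ 'd) measure" where
  "cube_lebesgue n = PiM {..<n} (\<lambda>_. restrict_space lborel unit_cube)"

definition partition_fun :: "'d::finite itself \<Rightarrow> nat \<Rightarrow> real \<Rightarrow> real" where
  "partition_fun _ n \<beta> =
     (\<integral>x. exp (- \<beta> * energy n x) \<partial>(cube_lebesgue n :: (nat \<Rightarrow> real ^ 'd) measure))"

definition coulomb_gas :: "nat \<Rightarrow> real \<Rightarrow> (nat \<Rightarrow> real ^ 'd) measure" where
  "coulomb_gas n \<beta> = density (cube_lebesgue n)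
     (\<lambda>x. ennreal (exp (- \<beta> * energy n x) / partition_fun TYPE('d) n \<beta>))"

definition num_points :: "nat \<Rightarrow> (real ^ 'd) set \<Rightarrow> (nat \<Rightarrow> real ^ 'd) \<Rightarrow> real" where
  "num_points n D x = real (card {i. i < n \<and> x i \<in> D})"

text \<open>Well-posedness: the gas is a probability measure and the point counts are random variables.\<close>

lemma unit_cube_borel [measurable]: "(unit_cube :: (real ^ 'd) set) \<in> sets borel"
  unfolding unit_cube_def by measurable

lemma dyadic_cube_borel [measurable]: "(dyadic_cube k i :: (real ^ 'd) set) \<in> sets borel"
  unfolding dyadic_cube_def by measurable

lemma emeasure_unit_cube: "emeasure lborel (unit_cube :: (real ^ 'd) set) = 1"
proof (rule antisym)
  define e :: "real ^ 'd" where "e = \<Sum>Basis"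
  have e_Basis: "e \<bullet> b = 1" if "b \<in> Basis" for b
    using that by (simp add: e_def)
  have e_component: "e $ l = 1" for l
    using e_Basis[of "axis l 1"] by (simp add: inner_axis)
  have lo: "box 0 e \<subseteq> unit_cube" and hi: "unit_cube \<subseteq> cbox 0 e"
    by (auto simp: unit_cube_def mem_box_cart e_component less_imp_le)
  show "emeasure lborel (unit_cube :: (real ^ 'd) set) \<le> 1"
    using emeasure_mono[OF hi, of lborel] by (simp add: emeasure_lborel_cbox_eq e_Basis)
  show "1 \<le> emeasure lborel (unit_cube :: (real ^ 'd) set)"
    using emeasure_mono[OF lo, of lborel] by (simp add: emeasure_lborel_box_eq e_Basis)
qed

lemma prob_space_cube_lebesgue: "prob_space (cube_lebesgue n :: (nat \<Rightarrow> real ^ 'd) measure)"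
  unfolding cube_lebesgue_def
  by (intro prob_space_PiM prob_spaceI)
     (simp add: emeasure_restrict_space space_restrict_space emeasure_unit_cube)

lemma finite_dyadic_cubes_level: "finite (dyadic_cubes_level k :: (real ^ 'd) set set)"
proof -
  have "{i :: 'd \<Rightarrow> nat. \<forall>l. i l \<le> 2 ^ k - 1} = Pi\<^sub>E UNIV (\<lambda>_. {.. 2 ^ k - 1})"
    by (auto simp: PiE_UNIV_domain)
  then have "finite {i :: 'd \<Rightarrow> nat. \<forall>l. i l \<le> 2 ^ k - 1}"
    by (simp add: finite_PiE)
  then show ?thesis
    unfolding dyadic_cubes_level_def by (simp add: setcompr_eq_image)
qed

lemma dyadic_cubes_borel: "(D :: (real ^ 'd) set) \<in> dyadic_cubes \<Longrightarrow> D \<in> sets borel"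
  unfolding dyadic_cubes_def dyadic_cubes_level_def by auto

lemma measurable_component_cube_lebesgue:
  "i < n \<Longrightarrow> (\<lambda>x. x i) \<in> (cube_lebesgue n :: (nat \<Rightarrow> real ^ 'd) measure) \<rightarrow>\<^sub>M borel"
  unfolding cube_lebesgue_def
  by (rule measurable_compose[OF measurable_component_singleton])
     (auto intro: measurable_restrict_space1)

lemma measurable_interaction:
  assumes [measurable]: "f \<in> M \<rightarrow>\<^sub>M borel" "g \<in> M \<rightarrow>\<^sub>M borel"
  shows "(\<lambda>x. interaction (f x :: real ^ 'd) (g x)) \<in> borel_measurable M"
proof -
  have [measurable]: "Measurable.pred M (\<lambda>x. same_dyadic_cube k (f x) (g x))" for k
    unfolding same_dyadic_cube_def
  proof (rule pred_intros_finite(4)[OF finite_dyadic_cubes_level])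
    fix D :: "(real ^ 'd) set"
    assume "D \<in> dyadic_cubes_level k"
    then have [measurable]: "D \<in> sets borel"
      unfolding dyadic_cubes_level_def by auto
    show "Measurable.pred M (\<lambda>x. f x \<in> D \<and> g x \<in> D)" by measurable
  qed
  have [measurable]: "(\<lambda>x. separation_level (f x) (g x)) \<in> M \<rightarrow>\<^sub>M count_space UNIV"
    unfolding separation_level_def by measurable
  show ?thesis unfolding interaction_def by measurable
qed

lemma measurable_energy [measurable]:
  "energy n \<in> borel_measurable (cube_lebesgue n :: (nat \<Rightarrow> real ^ 'd) measure)"
  unfolding energy_def
  by (intro borel_measurable_sum measurable_interaction measurable_component_cube_lebesgue) auto

lemma energy_nonneg: "0 \<le> energy n x"
  unfolding energy_def interaction_def by (intro sum_nonneg) auto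

lemma
  assumes "\<beta> > 0"
  shows partition_fun_pos: "partition_fun TYPE('d::finite) n \<beta> > 0"
    and prob_space_coulomb_gas: "prob_space (coulomb_gas n \<beta> :: (nat \<Rightarrow> real ^ 'd) measure)"
proof -
  let ?M = "cube_lebesgue n :: (nat \<Rightarrow> real ^ 'd) measure"
  let ?f = "\<lambda>x :: nat \<Rightarrow> real ^ 'd. exp (- \<beta> * energy n x)"
  interpret prob_space ?M by (rule prob_space_cube_lebesgue)
  have int: "integrable ?M ?f"
    by (rule integrable_const_bound[where B = 1]) (use assms in \<open>auto simp: energy_nonneg\<close>)
  show pos: "partition_fun TYPE('d) n \<beta> > 0"
    using integral_less_AE_space[of "\<lambda>_. 0" ?f] int emeasure_space_1
    by (simp add: partition_fun_def)
  show "prob_space (coulomb_gas n \<beta> :: (nat \<Rightarrow> real ^ 'd) measure)"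
  proof (rule prob_spaceI)
    have "(\<integral>\<^sup>+x. ennreal (?f x / partition_fun TYPE('d) n \<beta>) \<partial>?M)
        = ennreal (\<integral>x. ?f x / partition_fun TYPE('d) n \<beta> \<partial>?M)"
      using int pos by (intro nn_integral_eq_integral) auto
    also have "\<dots> = 1"
      using pos by (simp add: partition_fun_def)
    finally show "emeasure (coulomb_gas n \<beta>) (space (coulomb_gas n \<beta> :: (nat \<Rightarrow> real ^ 'd) measure)) = 1"
      unfolding coulomb_gas_def by (subst emeasure_density) (auto cong: nn_integral_cong)
  qed
qed

lemma measurable_num_points:
  assumes "D \<in> dyadic_cubes"
  shows "num_points n D \<in> borel_measurable (coulomb_gas n \<beta> :: (nat \<Rightarrow> real ^ 'd) measure)"
proof -
  have "num_points n D x = (\<Sum>i<n. indicator D (x i))" for x :: "nat \<Rightarrow> real ^ 'd"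
  proof -
    have "{i. i < n \<and> x i \<in> D} = {..<n} \<inter> {i. x i \<in> D}" by auto
    then show ?thesis
      by (simp add: num_points_def indicator_def sum.If_cases of_bool_def)
  qed
  moreover have "(\<lambda>x. \<Sum>i<n. indicator D (x i) :: real)
      \<in> borel_measurable (cube_lebesgue n :: (nat \<Rightarrow> real ^ 'd) measure)"
    using dyadic_cubes_borel[OF assms]
    by (intro borel_measurable_sum measurable_compose[OF measurable_component_cube_lebesgue]) auto
  ultimately show ?thesis
    unfolding coulomb_gas_def by (simp cong: measurable_cong)
qed

end

theory Submission
  imports Defs "HOL-Computational_Algebra.Formal_Power_Series" "HOL-Library.Sublist"
    "HOL-Real_Asymp.Real_Asymp"
begin

text \<open>Write $b = 2^d$ for the number of children of a cube and $q = 2^{d-2}$ for the factor by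
  which the interaction grows from one level to the next. Subtracting 1 from every interaction changes
  the energy by the constant $n(n-1)$ and leaves no interaction between points in different children of
  the unit cube. Two points in the same child then interact with strength
  $q w' - 1 = q (w' - 1) + (q - 1)$, where $w'$ is their interaction after the child has been rescaled
  to the unit cube. In terms of the exponential generating function
  of the partition functions in the number of points this says that the function at inverse
  temperature $\beta$ is the $b$-th power of the one at $q \beta$, after the latter has been
  multiplied coefficientwise by $e^{-\beta (q-1) m (m-1)}$.

  Coefficientwise multiplication by this factor preserves log-concavity, and so do products
  (\<open>log_concave_mult\<close>). By induction all these partition functions are log-concave
  (\<open>log_concave_gas_series\<close>). So the number of points in a child, given that there are $n$ points,
  has weights whose logarithm has second differences at most $-2 \beta (q-1)$. Such a distribution
  concentrates around its mode uniformly in $n$ (\<open>tilted_product_concentrates\<close>), and its mean is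
  $n / b$ by symmetry (\<open>weighted_power_nth\<close>). For a smaller dyadic cube one conditions on the count of
  the level-one cube around it: the fluctuation of that count is diluted by the factor $b^{-k}$,
  and the contributions of all levels form a geometric series (\<open>count_series_second_moment\<close>). Since
  the recursion raises the inverse temperature, one bound serves all levels.

  To start the induction, the interaction is capped at a finite depth $L$. The capped gas sees only
  the first $L$ binary digits of each point, so that its integrals are finite sums over words
  (\<open>integral_addresses\<close>), which the generating functions count (\<open>prefix_sum_count_series\<close>); at depth 0
  there is no excess interaction and the generating function is the exponential series. The bounds do
  not depend on $L$, and dominated convergence carries them to the hierarchical gas (\<open>gas_integral_limit\<close>).\<close>

unbundle no vec_syntax and fps_syntax

section \<open>Log-concave power series\<close>

text \<open>The inequality is required for arbitrary gaps rather than only for neighbouring coefficients.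
  For positive coefficients this is the same, but in the presence of zeros only this form excludes gaps in the
  support and is closed under products.\<close>

definition log_concave :: "real fps \<Rightarrow> bool" where
  "log_concave F \<longleftrightarrow>
     (\<forall>n. 0 \<le> F $ n) \<and> (\<forall>m n k. m \<le> n \<longrightarrow> F $ m * F $ (n + k) \<le> F $ (m + k) * F $ n)"

lemma log_concave_nonneg: "log_concave F \<Longrightarrow> 0 \<le> F $ n"
  by (simp add: log_concave_def)

lemma log_concaveD: "log_concave F \<Longrightarrow> m \<le> n \<Longrightarrow> F $ m * F $ (n + k) \<le> F $ (m + k) * F $ n"
  by (simp add: log_concave_def)

lemma log_concave_1: "log_concave 1"
  by (auto simp: log_concave_def)

lemma log_concave_fps_exp: "log_concave (fps_exp 1)"
proof -
  have "(1 / fact m :: real) * (1 / fact (n + k)) \<le> 1 / fact (m + k) * (1 / fact n)"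
    if "m \<le> n" for m n k :: nat
  proof (induction k)
    case (Suc k)
    have "(1 / fact m :: real) * (1 / fact (n + Suc k))
        = (1 / fact m) * (1 / fact (n + k)) / real (Suc (n + k))"
      by (simp add: field_simps)
    also have "\<dots> \<le> 1 / fact (m + k) * (1 / fact n) / real (Suc (m + k))"
      using that by (intro frac_le Suc) auto
    also have "\<dots> = 1 / fact (m + Suc k) * (1 / fact n)"
      by (simp add: field_simps)
    finally show ?case .
  qed auto
  then show ?thesis by (simp add: log_concave_def)
qed

text \<open>Coefficients indexed by the integers, so that a coefficient of a product is a sum over a range
  that does not depend on the coefficient.\<close>

definition extended_nth :: "real fps \<Rightarrow> int \<Rightarrow> real" where
  "extended_nth F i = (if i < 0 then 0 else F $ nat i)"

lemma extended_nth_log_concave: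
  assumes "log_concave F" "i \<le> j" "j \<le> l" "i + l = j + k"
  shows "extended_nth F i * extended_nth F l \<le> extended_nth F j * extended_nth F k"
proof (cases "i < 0")
  case True
  then show ?thesis
    using log_concave_nonneg[OF assms(1)] by (simp add: extended_nth_def)
next
  case False
  have eq: "nat k + nat (j - i) = nat l" "nat i + nat (j - i) = nat j" "nat i \<le> nat k"
    using False assms(2-4) by auto
  then have "F $ nat i * F $ nat l \<le> F $ nat j * F $ nat k"
    using log_concaveD[OF assms(1), of "nat i" "nat k" "nat (j - i)"] by simp
  then show ?thesis
    using False assms by (simp add: extended_nth_def)
qed

lemma extended_nth_mult:
  assumes "i \<le> int N" "0 \<le> d"
  shows "extended_nth (F * G) (i + d) =
    (\<Sum>k\<in>{-d..int N}. extended_nth F (i - k) * extended_nth G (k + d))"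
proof (cases "i + d < 0")
  case True
  have "extended_nth F (i - k) * extended_nth G (k + d) = 0" for k
    using True by (cases "k + d < 0") (auto simp: extended_nth_def)
  then have "(\<Sum>k\<in>{-d..int N}. extended_nth F (i - k) * extended_nth G (k + d)) = 0"
    by (intro sum.neutral) blast
  moreover have "extended_nth (F * G) (i + d) = 0"
    using True by (simp add: extended_nth_def)
  ultimately show ?thesis by simp
next
  case False
  let ?t = "\<lambda>k. extended_nth F (i - k) * extended_nth G (k + d)"
  have "extended_nth (F * G) (i + d) = (\<Sum>m=0..nat (i + d). F $ (nat (i + d) - m) * G $ m)"
    using False fps_mult_nth[of G F "nat (i + d)"] by (simp add: extended_nth_def mult.commute)
  also have "\<dots> = (\<Sum>k\<in>{-d..i}. ?t k)"
    using False assms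
    by (intro sum.reindex_bij_witness[of _ "\<lambda>k. nat (k + d)" "\<lambda>m. int m - d"])
      (auto simp: extended_nth_def intro!: arg_cong2[where f = "(*)"] arg_cong[where f = "fps_nth F"])
  also have "\<dots> = (\<Sum>k\<in>{-d..int N}. ?t k)"
    using assms by (intro sum.mono_neutral_left) (auto simp: extended_nth_def)
  finally show ?thesis .
qed

text \<open>Log-concavity says that the Toeplitz matrix of the coefficients has nonnegative minors of size 2,
  and the Toeplitz matrix of a product is the product of the matrices. So the reason is the
  Cauchy-Binet formula: a minor of the product is a sum of products of minors of the factors. The
  proof obtains it by symmetrizing a double sum.\<close>

lemma log_concave_mult:
  assumes F: "log_concave F" and G: "log_concave G"
  shows "log_concave (F * G)"
  unfolding log_concave_def
proof (intro conjI allI impI)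
  show "0 \<le> (F * G) $ n" for n
    using log_concave_nonneg[OF F] log_concave_nonneg[OF G]
    by (simp add: fps_mult_nth sum_nonneg)
  show "(F * G) $ m * (F * G) $ (n + d) \<le> (F * G) $ (m + d) * (F * G) $ n"
    if "m \<le> n" for m n d
  proof -
    let ?S = "{-int d..int n}" and ?C = "extended_nth (F * G)"
    define \<alpha> where "\<alpha> i k = extended_nth F (int i - k)" for i k
    define \<gamma>0 where "\<gamma>0 k = extended_nth G k" for k
    define \<gamma>1 where "\<gamma>1 k = extended_nth G (k + int d)" for k
    have c1: "(F * G) $ (i + d) = (\<Sum>k\<in>?S. \<alpha> i k * \<gamma>1 k)" if "i \<le> n" for i
      using extended_nth_mult[of "int i" n "int d" F G] that
      by (simp add: \<alpha>_def \<gamma>1_def extended_nth_def nat_add_distrib)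
    have c0: "(F * G) $ i = (\<Sum>k\<in>?S. \<alpha> i k * \<gamma>0 k)" if "i \<le> n" for i
    proof -
      have "(F * G) $ i = (\<Sum>k\<in>{0..int n}. \<alpha> i k * \<gamma>0 k)"
        using extended_nth_mult[of "int i" n 0 F G] that
        by (simp add: \<alpha>_def \<gamma>0_def extended_nth_def)
      also have "\<dots> = (\<Sum>k\<in>?S. \<alpha> i k * \<gamma>0 k)"
        by (intro sum.mono_neutral_left) (auto simp: \<gamma>0_def extended_nth_def)
      finally show ?thesis .
    qed
    define t where "t k l = \<alpha> n k * \<alpha> m l * (\<gamma>0 k * \<gamma>1 l - \<gamma>1 k * \<gamma>0 l)" for k l
    let ?D = "(F * G) $ (m + d) * (F * G) $ n - (F * G) $ m * (F * G) $ (n + d)"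
    have D: "?D = (\<Sum>k\<in>?S. \<Sum>l\<in>?S. t k l)"
    proof -
      have "(\<Sum>k\<in>?S. \<Sum>l\<in>?S. t k l) =
          (\<Sum>k\<in>?S. \<Sum>l\<in>?S. (\<alpha> n k * \<gamma>0 k) * (\<alpha> m l * \<gamma>1 l))
          - (\<Sum>k\<in>?S. \<Sum>l\<in>?S. (\<alpha> n k * \<gamma>1 k) * (\<alpha> m l * \<gamma>0 l))"
        by (simp add: t_def algebra_simps flip: sum_subtractf)
      also have "\<dots> = ?D"
        using that by (simp add: c0 c1 flip: sum_product)
      finally show ?thesis ..
    qed
    \<comment> \<open>Averaging over the exchange of $k$ and $l$ turns each summand into a product of two minors of equal sign.\<close>
    have "2 * ?D = (\<Sum>k\<in>?S. \<Sum>l\<in>?S. t k l) + (\<Sum>l\<in>?S. \<Sum>k\<in>?S. t k l)"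
      unfolding D using sum.swap[of t ?S ?S] by simp
    also have "\<dots> = (\<Sum>k\<in>?S. \<Sum>l\<in>?S.
        (\<alpha> n k * \<alpha> m l - \<alpha> n l * \<alpha> m k) * (\<gamma>0 k * \<gamma>1 l - \<gamma>1 k * \<gamma>0 l))"
      by (simp add: t_def algebra_simps flip: sum.distrib)
    also have "\<dots> \<ge> 0"
    proof (intro sum_nonneg)
      have minors: "\<alpha> n k * \<alpha> m l - \<alpha> n l * \<alpha> m k \<le> 0" "\<gamma>0 k * \<gamma>1 l - \<gamma>1 k * \<gamma>0 l \<le> 0"
        if "k \<le> l" for k l
        using extended_nth_log_concave[OF F, of "int m - l" "int n - l" "int n - k" "int m - k"]
          extended_nth_log_concave[OF G, of k "k + int d" "l + int d" l] that \<open>m \<le> n\<close>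
        by (simp_all add: \<alpha>_def \<gamma>0_def \<gamma>1_def mult.commute)
      show "0 \<le> (\<alpha> n k * \<alpha> m l - \<alpha> n l * \<alpha> m k) * (\<gamma>0 k * \<gamma>1 l - \<gamma>1 k * \<gamma>0 l)" for k l
        using minors[of k l] minors[of l k]
        by (cases "k \<le> l") (auto simp: mult.commute intro: mult_nonpos_nonpos mult_nonneg_nonneg)
    qed
    finally show ?thesis by simp
  qed
qed

lemma log_concave_power: "log_concave F \<Longrightarrow> log_concave (F ^ n)"
  by (induction n) (simp_all add: log_concave_1 log_concave_mult)

definition tilt :: "real \<Rightarrow> real fps \<Rightarrow> real fps" where
  "tilt \<gamma> F = Abs_fps (\<lambda>m. exp (- \<gamma> * (real m * (real m - 1))) * F $ m)"

lemma tilt_nth [simp]: "tilt \<gamma> F $ m = exp (- \<gamma> * (real m * (real m - 1))) * F $ m"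
  by (simp add: tilt_def)

text \<open>The quantitative gain: the tilt is the exponential of a quadratic, and
  $(n+k)^2 + m^2 - (m+k)^2 - n^2 = 2k(n-m)$.\<close>

lemma tilt_strongly_log_concave:
  assumes "log_concave F" "m \<le> n"
  shows "tilt \<gamma> F $ m * tilt \<gamma> F $ (n + k)
    \<le> exp (- 2 * \<gamma> * real k * (real n - real m)) * (tilt \<gamma> F $ (m + k) * tilt \<gamma> F $ n)"
proof -
  let ?e = "\<lambda>m. exp (- \<gamma> * (real m * (real m - 1)))"
  have "tilt \<gamma> F $ m * tilt \<gamma> F $ (n + k) = ?e m * ?e (n + k) * (F $ m * F $ (n + k))"
    by simp
  also have "\<dots> \<le> ?e m * ?e (n + k) * (F $ (m + k) * F $ n)"
    using log_concaveD[OF assms] by (intro mult_left_mono) auto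
  also have "?e m * ?e (n + k) = exp (- 2 * \<gamma> * real k * (real n - real m)) * (?e (m + k) * ?e n)"
    by (simp add: algebra_simps flip: exp_add)
  finally show ?thesis by (simp add: mult_ac)
qed

lemma log_concave_tilt:
  assumes "log_concave F" "0 \<le> \<gamma>"
  shows "log_concave (tilt \<gamma> F)"
  unfolding log_concave_def
proof (intro conjI allI impI)
  show "0 \<le> tilt \<gamma> F $ n" for n
    using log_concave_nonneg[OF assms(1)] by simp
  then have nonneg: "0 \<le> tilt \<gamma> F $ n" for n .
  show "tilt \<gamma> F $ m * tilt \<gamma> F $ (n + k) \<le> tilt \<gamma> F $ (m + k) * tilt \<gamma> F $ n" if "m \<le> n" for m n k
  proof -
    have "exp (- 2 * \<gamma> * real k * (real n - real m)) \<le> 1"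
      using that assms(2) by simp
    then show ?thesis
      using tilt_strongly_log_concave[OF assms(1) that, of \<gamma> k]
        mult_right_mono[of _ 1 "tilt \<gamma> F $ (m + k) * tilt \<gamma> F $ n"] nonneg
      by (meson mult_le_cancel_right1 mult_nonneg_nonneg order_trans mult_left_le_one_le exp_ge_zero)
  qed
qed

section \<open>Concentration of strongly log-concave weights\<close>

text \<open>The second moment of the two-sided weights $e^{-2 \beta (|j| - 1)}$, which dominate the
  distribution of a child count around its mode, relative to the weight of the mode.\<close>

definition tail_moment :: "real \<Rightarrow> real" where
  "tail_moment \<beta> = 2 * (\<Sum>j. real j ^ 2 * exp (- 2 * \<beta> * (real j - 1)))"

lemma tail_moment_summable:
  assumes "0 < \<beta>"
  shows "summable (\<lambda>j. real j ^ 2 * exp (- 2 * \<beta> * (real j - 1)))"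
proof -
  have "(\<lambda>j. real j ^ 2 * exp (- 2 * \<beta> * (real j - 1))) \<in> O(\<lambda>j. 1 / real j ^ 2)"
    using assms by real_asymp
  then show ?thesis
    by (rule summable_comparison_test_bigo[rotated]) (simp add: inverse_power_summable[of 2, simplified inverse_eq_divide])
qed

lemma tail_moment_antimono: "antimono_on {0<..} tail_moment"
proof (rule monotone_onI)
  fix \<beta> \<beta>' :: real assume "\<beta> \<in> {0<..}" "\<beta>' \<in> {0<..}" "\<beta> \<le> \<beta>'"
  moreover from this have "real j ^ 2 * exp (- 2 * \<beta>' * (real j - 1)) \<le> real j ^ 2 * exp (- 2 * \<beta> * (real j - 1))" for j
    by (cases "j = 0") (auto intro!: mult_left_mono mult_right_mono)
  ultimately show "tail_moment \<beta>' \<le> tail_moment \<beta>"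
    unfolding tail_moment_def
    by (intro mult_left_mono[OF suminf_le] tail_moment_summable) auto
qed

lemma tail_moment_nonneg: "0 < \<beta> \<Longrightarrow> 0 \<le> tail_moment \<beta>"
  unfolding tail_moment_def
  by (intro mult_nonneg_nonneg suminf_nonneg tail_moment_summable) auto

lemma log_concave_Suc: "log_concave F \<Longrightarrow> m \<le> n \<Longrightarrow> F $ m * F $ Suc n \<le> F $ Suc m * F $ n"
  using log_concaveD[of F m n 1] by simp

lemma sum_distance_le_suminf:
  fixes s :: "nat \<Rightarrow> real"
  assumes "summable s" "\<And>j. 0 \<le> s j"
  shows "(\<Sum>m\<le>n. s (if m \<le> M then M - m else m - M)) \<le> 2 * suminf s"
proof -
  let ?d = "\<lambda>m. if m \<le> M then M - m else m - M"
  have "(\<Sum>m\<le>n. s (?d m)) = (\<Sum>m\<in>{..n} \<inter> {..M}. s (M - m)) + (\<Sum>m\<in>{..n} - {..M}. s (m - M))"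
    by (subst sum.Int_Diff[of _ _ "{..M}"]) (auto intro!: arg_cong2[where f = "(+)"] sum.cong)
  also have "(\<Sum>m\<in>{..n} \<inter> {..M}. s (M - m)) = sum s ((\<lambda>m. M - m) ` ({..n} \<inter> {..M}))"
    by (subst sum.reindex) (auto simp: inj_on_def)
  also have "\<dots> \<le> suminf s"
    by (intro sum_le_suminf) (use assms in auto)
  also have "(\<Sum>m\<in>{..n} - {..M}. s (m - M)) = sum s ((\<lambda>m. m - M) ` ({..n} - {..M}))"
    by (subst sum.reindex) (auto simp: inj_on_def)
  also have "\<dots> \<le> suminf s"
    by (intro sum_le_suminf) (use assms in auto)
  finally show ?thesis by simp
qed

text \<open>With $M$ the mode of the weights $P(m)$, strong log-concavity compares the pair $(M, M + j)$
  with the pair $(M + 1, M + j - 1)$, whose weights are at most $P(M)$. This gives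
  $P(M) P(M + j) \le e^{-2 \beta (j-1)} P(M)^2$ at once, without an induction over $j$, and the same
  on the other side of the mode.\<close>

lemma tilted_product_concentrates:
  assumes F: "log_concave F" and H: "log_concave H" and \<beta>: "0 < \<beta>" "\<beta> \<le> \<gamma>"
  defines "P \<equiv> \<lambda>n m. tilt \<gamma> F $ m * H $ (n - m)"
  shows "\<exists>M. (\<Sum>m\<le>n. (real m - real M) ^ 2 * P n m) \<le> tail_moment \<beta> * (tilt \<gamma> F * H) $ n"
proof -
  let ?T = "tilt \<gamma> F"
  have nonneg: "0 \<le> P n m" for m
    unfolding P_def using log_concave_nonneg[OF H] log_concave_nonneg[OF F] by simp
  have total: "(?T * H) $ n = (\<Sum>m\<le>n. P n m)"
    by (simp add: fps_mult_nth P_def atMost_atLeast0)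
  have "finite (P n ` {..n})" "P n ` {..n} \<noteq> {}" by auto
  from Max_in[OF this] obtain M where M: "M \<le> n" "P n M = Max (P n ` {..n})"
    by (metis atMost_iff imageE)
  then have mode: "P n m \<le> P n M" if "m \<le> n" for m
    using that by simp
  \<comment> \<open>Compare with the indices \<open>i + 1\<close> and \<open>l - 1\<close>, whose weights are at most that of the mode.\<close>
  have pair: "P n i * P n l \<le> exp (- 2 * \<beta> * (real l - real i - 1)) * (P n M) ^ 2"
    if "i < l" "l \<le> n" for i l
  proof -
    have "?T $ i * ?T $ (l - 1 + 1)
        \<le> exp (- 2 * \<gamma> * real 1 * (real (l - 1) - real i)) * (?T $ (i + 1) * ?T $ (l - 1))"
      using that by (intro tilt_strongly_log_concave[OF F]) auto
    also have "\<dots> \<le> exp (- 2 * \<beta> * (real l - real i - 1)) * (?T $ (i + 1) * ?T $ (l - 1))"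
      using that \<beta> log_concave_nonneg[OF F] mult_right_mono[of \<beta> \<gamma> "real (l - 1) - real i"]
      by (intro mult_right_mono) (auto simp: of_nat_diff algebra_simps)
    finally have T: "?T $ i * ?T $ l
        \<le> exp (- 2 * \<beta> * (real l - real i - 1)) * (?T $ (i + 1) * ?T $ (l - 1))"
      using that by (simp del: tilt_nth)
    have "n - i = Suc (n - (i + 1))" "n - (l - 1) = Suc (n - l)"
      using that by auto
    then have "H $ (n - l) * H $ (n - i) \<le> H $ (n - (l - 1)) * H $ (n - (i + 1))"
      using log_concave_Suc[OF H, of "n - l" "n - (i + 1)"] that by simp
    from mult_mono[OF T this] have "P n i * P n l
        \<le> exp (- 2 * \<beta> * (real l - real i - 1)) * (P n (i + 1) * P n (l - 1))"
      using log_concave_nonneg[OF F] log_concave_nonneg[OF H] by (simp add: P_def mult_ac)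
    also have "\<dots> \<le> exp (- 2 * \<beta> * (real l - real i - 1)) * (P n M * P n M)"
      using that nonneg mode by (intro mult_left_mono mult_mono) auto
    finally show ?thesis by (simp add: power2_eq_square)
  qed
  define s where "s j = real j ^ 2 * exp (- 2 * \<beta> * (real j - 1))" for j
  let ?d = "\<lambda>m. if m \<le> M then M - m else m - M"
  have tail: "(real m - real M) ^ 2 * P n m \<le> s (?d m) * P n M" if "m \<le> n" for m
  proof (cases "m = M \<or> P n M = 0")
    case True
    then show ?thesis
      using mode[OF that] nonneg[of m] by (auto simp: s_def)
  next
    case False
    then have pos: "0 < P n M" using nonneg[of M] by simp
    have "P n M * P n m \<le> P n M * (exp (- 2 * \<beta> * (real (?d m) - 1)) * P n M)"
      using pair[of m M] pair[of M m] False that M(1)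
      by (cases "m < M") (auto simp: power2_eq_square mult_ac of_nat_diff)
    then have "P n m \<le> exp (- 2 * \<beta> * (real (?d m) - 1)) * P n M"
      using pos by simp
    moreover have "(real m - real M) ^ 2 = real (?d m) ^ 2"
      by (auto simp: of_nat_diff power2_commute)
    ultimately show ?thesis
      unfolding s_def mult.assoc by (simp only: mult_left_mono zero_le_power2)
  qed
  have "(\<Sum>m\<le>n. (real m - real M) ^ 2 * P n m) \<le> (\<Sum>m\<le>n. s (?d m)) * P n M"
    unfolding sum_distrib_right by (intro sum_mono tail) auto
  also have "\<dots> \<le> tail_moment \<beta> * (\<Sum>m\<le>n. P n m)"
  proof (rule mult_mono)
    show "(\<Sum>m\<le>n. s (?d m)) \<le> tail_moment \<beta>"
    proof -
      have "summable s" "tail_moment \<beta> = 2 * suminf s"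
        using tail_moment_summable[OF \<beta>(1)] by (simp_all add: tail_moment_def s_def[abs_def])
      then show ?thesis
        using sum_distance_le_suminf[of s M n] by (simp add: s_def)
    qed
    show "P n M \<le> (\<Sum>m\<le>n. P n m)"
      using M(1) nonneg by (intro member_le_sum) auto
    show "0 \<le> tail_moment \<beta>"
      by (rule tail_moment_nonneg[OF \<beta>(1)])
  qed (rule nonneg)
  finally show ?thesis
    unfolding total by blast
qed

text \<open>Among $b$ exchangeable counts with total $n$ each has mean $n / b$. In terms of generating functions
  this is the identity $b \cdot X F' \cdot F^{b-1} = X (F^b)'$.\<close>

lemma weighted_power_nth:
  fixes F :: "real fps"
  assumes "0 < b"
  shows "(\<Sum>m\<le>n. real m * (F $ m * (F ^ (b - 1)) $ (n - m))) = real n / real b * (F ^ b) $ n"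
proof -
  have "real n * (F ^ b) $ n = (fps_X * fps_deriv (F ^ b)) $ n"
    by (cases n) auto
  also have "fps_X * fps_deriv (F ^ b) = fps_const (real b) * ((fps_X * fps_deriv F) * F ^ (b - 1))"
    by (simp add: fps_deriv_power mult_ac)
  also have "\<dots> $ n = real b * (\<Sum>m\<le>n. (fps_X * fps_deriv F) $ m * (F ^ (b - 1)) $ (n - m))"
    unfolding fps_mult_left_const_nth fps_mult_nth[of "fps_X * fps_deriv F"] atMost_atLeast0 ..
  also have "(\<Sum>m\<le>n. (fps_X * fps_deriv F) $ m * (F ^ (b - 1)) $ (n - m))
      = (\<Sum>m\<le>n. real m * (F $ m * (F ^ (b - 1)) $ (n - m)))"
  proof (intro sum.cong refl)
    show "(fps_X * fps_deriv F) $ m * (F ^ (b - 1)) $ (n - m)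
        = real m * (F $ m * (F ^ (b - 1)) $ (n - m))" for m
      by (cases m) auto
  qed
  finally show ?thesis
    using assms by (simp add: field_simps)
qed

text \<open>The variance is at most the second moment around any point, here around the mode.\<close>

lemma tilted_power_second_moment:
  assumes F: "log_concave F" and "0 < \<beta>" "\<beta> \<le> \<gamma>" "0 < b"
  defines "T \<equiv> tilt \<gamma> F"
  shows "(\<Sum>m\<le>n. real m ^ 2 * (T $ m * (T ^ (b - 1)) $ (n - m)))
    \<le> (tail_moment \<beta> + (real n / real b) ^ 2) * (T ^ b) $ n"
proof -
  define P where "P m = T $ m * (T ^ (b - 1)) $ (n - m)" for m
  have T: "log_concave T"
    unfolding T_def using assms by (intro log_concave_tilt) auto
  have Tb: "T * T ^ (b - 1) = T ^ b"
    using assms by (simp flip: power_Suc)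
  then have total: "(T ^ b) $ n = (\<Sum>m\<le>n. P m)"
    by (metis (no_types, lifting) P_def atMost_atLeast0 fps_mult_nth sum.cong)
  have mean: "(\<Sum>m\<le>n. real m * P m) = real n / real b * (T ^ b) $ n"
    unfolding P_def using assms by (intro weighted_power_nth)
  obtain M where M: "(\<Sum>m\<le>n. (real m - real M) ^ 2 * P m) \<le> tail_moment \<beta> * (T ^ b) $ n"
    using tilted_product_concentrates[OF F log_concave_power[OF T, of "b - 1"] assms(2,3), where n = n]
    unfolding P_def T_def[symmetric] Tb by blast
  let ?\<mu> = "real n / real b"
  have "(\<Sum>m\<le>n. real m ^ 2 * P m) = (\<Sum>m\<le>n. (real m - real M) ^ 2 * P m)
      + 2 * real M * (\<Sum>m\<le>n. real m * P m) - real M ^ 2 * (\<Sum>m\<le>n. P m)"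
    by (simp add: sum_distrib_left sum_distrib_right sum.distrib sum_subtractf power2_diff algebra_simps)
  also have "\<dots> \<le> (tail_moment \<beta> + 2 * real M * ?\<mu> - real M ^ 2) * (T ^ b) $ n"
    using M unfolding mean total[symmetric] by (simp add: algebra_simps)
  also have "\<dots> \<le> (tail_moment \<beta> + ?\<mu> ^ 2) * (T ^ b) $ n"
    using log_concave_nonneg[OF log_concave_power[OF T]] sum_squares_bound[of "real M" ?\<mu>]
    by (intro mult_right_mono) (auto simp: mult_ac)
  finally show ?thesis unfolding P_def .
qed

section \<open>The recursion over levels\<close>

text \<open>The coefficient of $X^n$ is the sum of the Boltzmann weights of the configurations of $n$ labelled
  points on the words of length $L$ over $b$ letters, divided by $n!$; the interaction is reduced by 1
  and capped at depth $L$ (see \<open>prefix_sum_gas_series\<close>).\<close>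

primrec gas_series :: "real \<Rightarrow> nat \<Rightarrow> nat \<Rightarrow> real \<Rightarrow> real fps" where
  "gas_series q b 0 \<beta> = fps_exp 1"
| "gas_series q b (Suc L) \<beta> = tilt (\<beta> * (q - 1)) (gas_series q b L (q * \<beta>)) ^ b"

lemma log_concave_gas_series:
  "1 \<le> q \<Longrightarrow> 0 \<le> \<beta> \<Longrightarrow> log_concave (gas_series q b L \<beta>)"
  by (induction L arbitrary: \<beta>)
    (auto intro!: log_concave_fps_exp log_concave_power log_concave_tilt)

text \<open>As \<open>gas_series\<close> at depth $k + j$, with each configuration weighted by $h$ of the number of
  points in a fixed cube of level $k$. The recursion follows the path from the unit cube to that cube:
  one child contains the cube, the other $b - 1$ children are unweighted.\<close>

primrec count_series ::
    "real \<Rightarrow> nat \<Rightarrow> (nat \<Rightarrow> real) \<Rightarrow> nat \<Rightarrow> nat \<Rightarrow> real \<Rightarrow> real fps" where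
  "count_series q b h j 0 \<beta> = Abs_fps (\<lambda>n. h n * gas_series q b j \<beta> $ n)"
| "count_series q b h j (Suc k) \<beta> =
    tilt (\<beta> * (q - 1)) (count_series q b h j k (q * \<beta>))
    * tilt (\<beta> * (q - 1)) (gas_series q b (k + j) (q * \<beta>)) ^ (b - 1)"

lemma count_series_const:
  assumes "0 < b"
  shows "count_series q b (\<lambda>_. 1) j k \<beta> = gas_series q b (k + j) \<beta>"
proof (induction k arbitrary: \<beta>)
  case (Suc k)
  have "T * T ^ (b - 1) = T ^ b" for T :: "real fps"
    using assms by (simp flip: power_Suc)
  then show ?case
    by (simp only: count_series.simps gas_series.simps add_Suc Suc)
qed (simp add: fps_eq_iff)

lemma count_series_first_moment:
  assumes "0 < b"
  shows "count_series q b real j k \<beta> $ n = real n / real b ^ k * gas_series q b (k + j) \<beta> $ n"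
proof (induction k arbitrary: \<beta> n)
  case (Suc k)
  let ?T = "tilt (\<beta> * (q - 1)) (gas_series q b (k + j) (q * \<beta>))"
  have "tilt (\<beta> * (q - 1)) (count_series q b real j k (q * \<beta>)) $ m = real m / real b ^ k * ?T $ m" for m
    by (simp add: Suc)
  then have "count_series q b real j (Suc k) \<beta> $ n
      = (\<Sum>m\<le>n. real m * (?T $ m * (?T ^ (b - 1)) $ (n - m))) / real b ^ k"
    by (simp add: fps_mult_nth atMost_atLeast0 sum_divide_distrib mult_ac del: tilt_nth)
  also have "\<dots> = real n / real b ^ Suc k * (?T ^ b) $ n"
    unfolding weighted_power_nth[OF assms] by simp
  finally show ?case by simp
qed simp

text \<open>The law of total variance, for a cube of level $k + 1$. If the level-one cube around it contains $m$ points, then the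
  conditional mean of the count is $m / b^k$ and its conditional variance is bounded by the induction
  hypothesis, at the higher inverse temperature $q \beta$. The fluctuation of $m$ itself adds
  at most $b^{-2k}$ times \<open>tail_moment\<close>. The lower bound $\beta_0$ on the inverse temperature is kept
  fixed so that one constant serves all levels.\<close>

lemma count_series_second_moment:
  assumes "2 \<le> q" "2 \<le> b" "0 < \<beta>0" "\<beta>0 \<le> \<beta>"
  shows "count_series q b (\<lambda>m. real m ^ 2) j k \<beta> $ n
    \<le> (2 * tail_moment \<beta>0 * (1 - 1 / 2 ^ k) + (real n / real b ^ k) ^ 2) * gas_series q b (k + j) \<beta> $ n"
  using assms(4)
proof (induction k arbitrary: \<beta> n)
  case (Suc k)
  define K where "K = tail_moment \<beta>0"
  let ?S = "gas_series q b (k + j) (q * \<beta>)" and ?C = "count_series q b (\<lambda>m. real m ^ 2) j k (q * \<beta>)"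
  define T where "T = tilt (\<beta> * (q - 1)) ?S"
  have "1 * \<beta> \<le> q * \<beta>" "\<beta> * 1 \<le> \<beta> * (q - 1)"
    using Suc.prems assms by (auto intro!: mult_right_mono mult_left_mono)
  then have le: "\<beta>0 \<le> q * \<beta>" "\<beta>0 \<le> \<beta> * (q - 1)"
    using Suc.prems by simp_all
  have S: "log_concave ?S"
    using assms Suc.prems by (intro log_concave_gas_series) auto
  have T: "log_concave T"
    unfolding T_def using assms Suc.prems by (intro log_concave_tilt S) auto
  have "0 \<le> K"
    unfolding K_def by (rule tail_moment_nonneg[OF assms(3)])
  have C: "tilt (\<beta> * (q - 1)) ?C $ m
      \<le> (2 * K * (1 - 1 / 2 ^ k) + (real m / real b ^ k) ^ 2) * T $ m" for m
    using mult_left_mono[OF Suc.IH[OF le(1), of m], of "exp (- (\<beta> * (q - 1)) * (real m * (real m - 1)))"]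
    by (simp add: K_def T_def mult_ac)
  have "count_series q b (\<lambda>m. real m ^ 2) j (Suc k) \<beta> $ n
      = (\<Sum>m\<le>n. tilt (\<beta> * (q - 1)) ?C $ m * (T ^ (b - 1)) $ (n - m))"
    by (simp add: fps_mult_nth atMost_atLeast0 T_def del: tilt_nth)
  also have "\<dots> \<le> (\<Sum>m\<le>n. (2 * K * (1 - 1 / 2 ^ k) + (real m / real b ^ k) ^ 2) * T $ m * (T ^ (b - 1)) $ (n - m))"
    by (intro sum_mono mult_right_mono C log_concave_nonneg[OF log_concave_power[OF T]])
  also have "\<dots> = 2 * K * (1 - 1 / 2 ^ k) * (\<Sum>m\<le>n. T $ m * (T ^ (b - 1)) $ (n - m))
      + (\<Sum>m\<le>n. real m ^ 2 * (T $ m * (T ^ (b - 1)) $ (n - m))) / (real b ^ k) ^ 2"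
    by (simp add: sum_distrib_left sum_divide_distrib power_divide algebra_simps flip: sum.distrib)
  also have "(\<Sum>m\<le>n. T $ m * (T ^ (b - 1)) $ (n - m)) = (T * T ^ (b - 1)) $ n"
    by (simp add: fps_mult_nth atMost_atLeast0)
  also have "T * T ^ (b - 1) = T ^ b"
    using assms by (simp flip: power_Suc)
  also have "2 * K * (1 - 1 / 2 ^ k) * (T ^ b) $ n
      + (\<Sum>m\<le>n. real m ^ 2 * (T $ m * (T ^ (b - 1)) $ (n - m))) / (real b ^ k) ^ 2
    \<le> 2 * K * (1 - 1 / 2 ^ k) * (T ^ b) $ n + (K + (real n / real b) ^ 2) * (T ^ b) $ n / (real b ^ k) ^ 2"
    unfolding T_def K_def using assms le
    by (intro add_left_mono divide_right_mono tilted_power_second_moment S) auto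
  also have "2 * K * (1 - 1 / 2 ^ k) * (T ^ b) $ n + (K + (real n / real b) ^ 2) * (T ^ b) $ n / (real b ^ k) ^ 2
     = (2 * K * (1 - 1 / 2 ^ k) + K / (real b ^ k) ^ 2 + (real n / real b ^ Suc k) ^ 2) * (T ^ b) $ n"
    using assms by (simp add: field_simps power2_eq_square)
  also have "\<dots> \<le> (2 * K * (1 - 1 / 2 ^ Suc k) + (real n / real b ^ Suc k) ^ 2) * (T ^ b) $ n"
  proof (intro mult_right_mono add_right_mono log_concave_nonneg[OF log_concave_power[OF T]])
    have "(2::real) ^ k \<le> real b ^ k" 
      using assms by (intro power_mono) auto
    also have "\<dots> \<le> (real b ^ k) ^ 2"
      using assms by (intro self_le_power) auto
    finally have "K / (real b ^ k) ^ 2 \<le> K / 2 ^ k"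
      using \<open>0 \<le> K\<close> assms by (intro divide_left_mono) auto
    then show "2 * K * (1 - 1 / 2 ^ k) + K / (real b ^ k) ^ 2 \<le> 2 * K * (1 - 1 / 2 ^ Suc k)"
      by (simp add: algebra_simps)
  qed
  finally show ?case by (simp add: K_def T_def)
qed (use assms in simp)

section \<open>Partition functions of words as power series\<close>

text \<open>Two points interact with strength $q^p$, where $p$ is the length of the common prefix of their
  words. The constant 1, which is also felt by points with different first letters, is removed.\<close>

definition excess_energy :: "real \<Rightarrow> nat set \<Rightarrow> (nat \<Rightarrow> 'c list) \<Rightarrow> real" where
  "excess_energy q I x =
    (\<Sum>i\<in>I. \<Sum>j\<in>I - {i}. q ^ length (longest_common_prefix (x i) (x j)) - 1)"

text \<open>For constant $h = 1$ this is the partition function of labelled points on the words in $A$. The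
  prefix $s$ plays the role of a dyadic cube whose points are counted.\<close>

definition prefix_sum ::
    "real \<Rightarrow> real \<Rightarrow> 'c list set \<Rightarrow> 'c list \<Rightarrow> (nat \<Rightarrow> real) \<Rightarrow> nat set \<Rightarrow> real" where
  "prefix_sum q \<beta> A s h I =
    (\<Sum>x\<in>PiE I (\<lambda>_. A). exp (- \<beta> * excess_energy q I x) * h (card {i\<in>I. prefix s (x i)}))"

lemma excess_energy_cong:
  "(\<And>i. i \<in> I \<Longrightarrow> x i = y i) \<Longrightarrow> excess_energy q I x = excess_energy q I y"
  unfolding excess_energy_def by (intro sum.cong refl) auto

lemma excess_energy_Un:
  assumes "finite I" "J \<subseteq> I"
    and "\<And>i j. i \<in> J \<Longrightarrow> j \<in> I - J \<Longrightarrow> longest_common_prefix (x i) (x j) = []"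
    and "\<And>i j. i \<in> J \<Longrightarrow> j \<in> I - J \<Longrightarrow> longest_common_prefix (x j) (x i) = []"
  shows "excess_energy q I x = excess_energy q J x + excess_energy q (I - J) x"
proof -
  let ?w = "\<lambda>i j. q ^ length (longest_common_prefix (x i) (x j)) - 1"
  have inside: "(\<Sum>j\<in>I - {i}. ?w i j) = (\<Sum>j\<in>J - {i}. ?w i j)" if "i \<in> J" for i
  proof (intro sum.mono_neutral_right ballI)
    fix j assume "j \<in> I - {i} - (J - {i})"
    then have "j \<in> I - J" using that by auto
    then show "?w i j = 0" by (simp add: assms(3)[OF that])
  qed (use assms(1,2) in auto)
  have outside: "(\<Sum>j\<in>I - {i}. ?w i j) = (\<Sum>j\<in>I - J - {i}. ?w i j)" if "i \<in> I - J" for i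
    using assms(1,2) by (intro sum.mono_neutral_right ballI) (auto simp: assms(4)[OF _ that])
  have "excess_energy q I x = (\<Sum>i\<in>J. \<Sum>j\<in>I - {i}. ?w i j) + (\<Sum>i\<in>I - J. \<Sum>j\<in>I - {i}. ?w i j)"
    unfolding excess_energy_def using assms by (subst sum.subset_diff[of J]) auto
  then show ?thesis
    by (simp add: excess_energy_def inside outside)
qed

lemma sum_PiE_Un:
  fixes f :: "('i \<Rightarrow> 'a) \<Rightarrow> real"
  assumes "finite I" "finite A" "finite B" "A \<inter> B = {}"
  shows "(\<Sum>x\<in>PiE I (\<lambda>_. A \<union> B). f x) =
    (\<Sum>J\<in>Pow I. \<Sum>y\<in>PiE J (\<lambda>_. A). \<Sum>z\<in>PiE (I - J) (\<lambda>_. B). f (\<lambda>i. if i \<in> J then y i else z i))"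
proof -
  let ?S = "SIGMA J:Pow I. PiE J (\<lambda>_. A) \<times> PiE (I - J) (\<lambda>_. B)"
  have "(\<Sum>x\<in>PiE I (\<lambda>_. A \<union> B). f x) = (\<Sum>(J, y, z)\<in>?S. f (\<lambda>i. if i \<in> J then y i else z i))"
  proof (rule sum.reindex_bij_witness[of _ "\<lambda>(J, y, z) i. if i \<in> J then y i else z i"
      "\<lambda>x. ({i\<in>I. x i \<in> A}, restrict x {i\<in>I. x i \<in> A}, restrict x (I - {i\<in>I. x i \<in> A}))"], goal_cases)
    case (1 x)
    then show ?case by (auto simp: fun_eq_iff PiE_def extensional_def)
  next
    case (2 x)
    then show ?case by (auto simp: PiE_def extensional_def)
  next
    case (3 p)
    obtain J y z where p: "p = (J, y, z)" by (cases p)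
    with 3 have JI: "J \<subseteq> I" and y: "y \<in> PiE J (\<lambda>_. A)" and z: "z \<in> PiE (I - J) (\<lambda>_. B)" by auto
    have J: "{i\<in>I. (if i \<in> J then y i else z i) \<in> A} = J"
    proof -
      have "z i \<notin> A" if "i \<in> I - J" for i
        using PiE_mem[OF z that] assms(4) by auto
      then show ?thesis using JI PiE_mem[OF y] by auto
    qed
    have "restrict (\<lambda>i. if i \<in> J then y i else z i) J = y"
      using y by (auto simp: fun_eq_iff PiE_def extensional_def)
    moreover have "restrict (\<lambda>i. if i \<in> J then y i else z i) (I - J) = z"
      using z by (auto simp: fun_eq_iff PiE_def extensional_def)
    ultimately show ?case by (simp add: p J)
  next
    case (4 p)
    then show ?case by (auto simp: PiE_def Pi_iff extensional_def split: if_splits)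
  next
    case (5 x)
    then show ?case
      by (auto intro!: arg_cong[where f = f] simp: fun_eq_iff PiE_def extensional_def)
  qed
  also have "\<dots> = (\<Sum>J\<in>Pow I. \<Sum>p\<in>PiE J (\<lambda>_. A) \<times> PiE (I - J) (\<lambda>_. B). case p of (y, z) \<Rightarrow> f (\<lambda>i. if i \<in> J then y i else z i))"
    using assms by (subst sum.Sigma) (auto intro!: finite_PiE intro: finite_subset)
  finally show ?thesis
    by (simp add: sum.cartesian_product)
qed

text \<open>Words with different first letters have excess interaction 0, so the Boltzmann weight factorizes
  once it is known which points lie in which part.\<close>

lemma prefix_sum_Un:
  assumes "finite I" "finite A" "finite B" "A \<inter> B = {}"
    and apart: "\<And>u v. u \<in> A \<Longrightarrow> v \<in> B \<Longrightarrow> longest_common_prefix u v = [] \<and> longest_common_prefix v u = []"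
    and s: "\<And>v. v \<in> B \<Longrightarrow> \<not> prefix s v"
  shows "prefix_sum q \<beta> (A \<union> B) s h I =
    (\<Sum>J\<in>Pow I. prefix_sum q \<beta> A s h J * prefix_sum q \<beta> B s (\<lambda>_. 1) (I - J))"
  unfolding prefix_sum_def sum_PiE_Un[OF assms(1-4)]
proof (intro sum.cong refl)
  fix J assume J: "J \<in> Pow I"
  let ?m = "\<lambda>y z i. if i \<in> J then y i else z i"
  have split: "excess_energy q I (?m y z) = excess_energy q J y + excess_energy q (I - J) z"
    and count: "card {i\<in>I. prefix s (?m y z i)} = card {i\<in>J. prefix s (y i)}"
    if y: "y \<in> PiE J (\<lambda>_. A)" and z: "z \<in> PiE (I - J) (\<lambda>_. B)" for y z
  proof -
    have "excess_energy q I (?m y z) = excess_energy q J (?m y z) + excess_energy q (I - J) (?m y z)"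
      using J assms(1) apart PiE_mem[OF y] PiE_mem[OF z] by (intro excess_energy_Un) auto
    also have "excess_energy q J (?m y z) = excess_energy q J y"
      by (rule excess_energy_cong) simp
    also have "excess_energy q (I - J) (?m y z) = excess_energy q (I - J) z"
      by (rule excess_energy_cong) simp
    finally show "excess_energy q I (?m y z) = excess_energy q J y + excess_energy q (I - J) z" .
    have "{i\<in>I. prefix s (?m y z i)} = {i\<in>J. prefix s (y i)}"
      using J s[OF PiE_mem[OF z]] by auto
    then show "card {i\<in>I. prefix s (?m y z i)} = card {i\<in>J. prefix s (y i)}" by simp
  qed
  show "(\<Sum>y\<in>PiE J (\<lambda>_. A). \<Sum>z\<in>PiE (I - J) (\<lambda>_. B).
        exp (- \<beta> * excess_energy q I (?m y z)) * h (card {i\<in>I. prefix s (?m y z i)})) =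
      (\<Sum>x\<in>PiE J (\<lambda>_. A). exp (- \<beta> * excess_energy q J x) * h (card {i\<in>J. prefix s (x i)})) *
      (\<Sum>x\<in>PiE (I - J) (\<lambda>_. B). exp (- \<beta> * excess_energy q (I - J) x) * 1)"
    unfolding sum_product
    by (intro sum.cong refl) (simp only: split count distrib_left exp_add mult_ac mult_1_right)
qed

text \<open>A common first letter turns the excess $q^p - 1$ into $q^{p+1} - 1 = q (q^p - 1) + (q - 1)$: the
  inverse temperature is multiplied by $q$, and each ordered pair pays an additional $q - 1$.\<close>

lemma prefix_sum_Cons:
  assumes "finite I"
  shows "prefix_sum q \<beta> ((#) a ` A) (a # s) h I =
    exp (- (\<beta> * (q - 1)) * (real (card I) * (real (card I) - 1))) * prefix_sum q (q * \<beta>) A s h I"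
proof -
  let ?c = "real (card I) * (real (card I) - 1)"
  have energy: "excess_energy q I (\<lambda>i. a # y i) = q * excess_energy q I y + (q - 1) * ?c" for y
  proof -
    have "excess_energy q I (\<lambda>i. a # y i) =
        (\<Sum>i\<in>I. \<Sum>j\<in>I - {i}. q * (q ^ length (longest_common_prefix (y i) (y j)) - 1) + (q - 1))"
      by (simp add: excess_energy_def algebra_simps)
    also have "\<dots> = q * excess_energy q I y + (\<Sum>i\<in>I. \<Sum>j\<in>I - {i}. q - 1)"
      by (simp add: excess_energy_def sum.distrib sum_distrib_left)
    also have "(\<Sum>i\<in>I. \<Sum>j\<in>I - {i}. q - 1) = (\<Sum>i\<in>I. (real (card I) - 1) * (q - 1))"
    proof (intro sum.cong refl)
      fix i assume "i \<in> I"
      then have "0 < card I" using assms by (auto simp: card_gt_0_iff)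
      with \<open>i \<in> I\<close> show "(\<Sum>j\<in>I - {i}. q - 1) = (real (card I) - 1) * (q - 1)"
        using assms by (simp add: card_Diff_singleton of_nat_diff)
    qed
    finally show ?thesis by (simp add: mult_ac)
  qed
  have "prefix_sum q \<beta> ((#) a ` A) (a # s) h I =
    (\<Sum>y\<in>PiE I (\<lambda>_. A). exp (- \<beta> * excess_energy q I (\<lambda>i. a # y i)) * h (card {i\<in>I. prefix s (y i)}))"
    unfolding prefix_sum_def
  proof (rule sum.reindex_bij_witness[of _ "\<lambda>y. restrict (\<lambda>i. a # y i) I" "\<lambda>x. restrict (\<lambda>i. tl (x i)) I"], goal_cases)
    case (1 x)
    then show ?case by (force simp: fun_eq_iff PiE_def extensional_def)
  next
    case (2 x)
    then show ?case by (force simp: PiE_def)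
  next
    case (3 y)
    then show ?case by (auto simp: fun_eq_iff PiE_def extensional_def)
  next
    case (4 y)
    then show ?case by auto
  next
    case (5 x)
    have x: "a # tl (x i) = x i" if "i \<in> I" for i
      using PiE_mem[OF 5 that] by auto
    have "excess_energy q I (\<lambda>i. a # restrict (\<lambda>i. tl (x i)) I i) = excess_energy q I x"
      by (rule excess_energy_cong) (simp add: x)
    moreover have "{i\<in>I. prefix s (restrict (\<lambda>i. tl (x i)) I i)} = {i\<in>I. prefix (a # s) (x i)}"
      using x by (auto simp: Cons_prefix_Cons) (metis Cons_prefix_Cons)+
    ultimately show ?case by simp
  qed
  moreover have "exp (- \<beta> * (q * e + (q - 1) * ?c)) = exp (- (\<beta> * (q - 1)) * ?c) * exp (- (q * \<beta>) * e)" for e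
    by (simp add: algebra_simps flip: exp_add)
  ultimately show ?thesis
    unfolding prefix_sum_def sum_distrib_left by (simp only: energy mult.assoc)
qed

lemma prefix_sum_const: "prefix_sum q \<beta> A s (\<lambda>_. 1) I = prefix_sum q \<beta> A [] (\<lambda>_. 1) I"
  by (simp add: prefix_sum_def)

text \<open>The product rule for exponential generating functions of labelled structures.\<close>

lemma sum_Pow_fps_mult:
  fixes F G :: "real fps"
  assumes "finite I"
  shows "(\<Sum>J\<in>Pow I. (fact (card J) * F $ card J) * (fact (card (I - J)) * G $ card (I - J)))
    = fact (card I) * (F * G) $ card I"
proof -
  let ?n = "card I"
  let ?t = "\<lambda>m. (fact m * F $ m) * (fact (?n - m) * G $ (?n - m)) :: real"
  have "(\<Sum>J\<in>Pow I. (fact (card J) * F $ card J) * (fact (card (I - J)) * G $ card (I - J)))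
      = (\<Sum>J\<in>Pow I. ?t (card J))"
    using assms by (intro sum.cong refl) (auto simp: card_Diff_subset finite_subset)
  also have "\<dots> = (\<Sum>m\<in>{0..?n}. \<Sum>J | J \<in> Pow I \<and> card J = m. ?t (card J))"
    using assms by (intro sum.group[symmetric]) (auto intro: card_mono)
  also have "\<dots> = (\<Sum>m\<in>{0..?n}. real (?n choose m) * ?t m)"
    using n_subsets[OF assms] by (intro sum.cong refl) (simp add: Pow_def)
  also have "\<dots> = (\<Sum>m\<in>{0..?n}. fact ?n * (F $ m * G $ (?n - m)))"
    by (intro sum.cong refl) (simp add: binomial_fact)
  finally show ?thesis
    by (simp add: fps_mult_nth sum_distrib_left)
qed

lemma prefix_sum_children:
  assumes fin: "finite (A :: 'c::finite set)" "finite I"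
    and child: "\<And>a J. finite J \<Longrightarrow>
      prefix_sum q \<beta> ((#) a ` W) [] (\<lambda>_. 1) J = fact (card J) * F $ card J"
    and W: "finite W"
  shows "prefix_sum q \<beta> (\<Union>a\<in>A. (#) a ` W) [] (\<lambda>_. 1) I = fact (card I) * (F ^ card A) $ card I"
  using fin
proof (induction A arbitrary: I rule: finite_induct)
  case empty
  then show ?case
    by (cases "I = {}") (auto simp: prefix_sum_def excess_energy_def PiE_eq_empty_iff card_gt_0_iff)
next
  case (insert a A)
  have "prefix_sum q \<beta> ((#) a ` W \<union> (\<Union>a\<in>A. (#) a ` W)) [] (\<lambda>_. 1) I
    = prefix_sum q \<beta> ((#) a ` W \<union> (\<Union>a\<in>A. (#) a ` W)) [a] (\<lambda>_. 1) I"
    by (simp add: prefix_sum_const[of _ _ _ "[a]"])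
  also have "\<dots> = (\<Sum>J\<in>Pow I. prefix_sum q \<beta> ((#) a ` W) [a] (\<lambda>_. 1) J
      * prefix_sum q \<beta> (\<Union>a\<in>A. (#) a ` W) [a] (\<lambda>_. 1) (I - J))"
    using insert.hyps insert.prems W by (intro prefix_sum_Un) auto
  also have "\<dots> = (\<Sum>J\<in>Pow I. (fact (card J) * F $ card J)
      * (fact (card (I - J)) * (F ^ card A) $ card (I - J)))"
    using insert.IH insert.prems child prefix_sum_const[of _ _ _ "[a]"]
    by (intro sum.cong refl) (auto simp: finite_subset)
  also have "\<dots> = fact (card I) * (F * F ^ card A) $ card I"
    by (rule sum_Pow_fps_mult[OF insert.prems])
  finally show ?case
    using insert by simp
qed

lemma finite_words: "finite {u :: 'c::finite list. length u = L}"
  using finite_lists_length_eq[of "UNIV :: 'c set" L] by simp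

lemma words_Suc: "{u. length u = Suc L} = (\<Union>a. (#) a ` {u. length u = L})"
  by (auto simp: length_Suc_conv)

lemma prefix_sum_gas_series:
  assumes "finite I"
  shows "prefix_sum q \<beta> {u :: 'c::finite list. length u = L} s (\<lambda>_. 1) I
    = fact (card I) * gas_series q CARD('c) L \<beta> $ card I"
  using assms
proof (induction L arbitrary: \<beta> I s)
  case 0
  have "PiE I (\<lambda>_. {[]}) = {restrict (\<lambda>_. []) I}"
    using PiE_singleton[of "restrict (\<lambda>_. []) I" I] by simp
  then show ?case
    by (simp add: prefix_sum_def excess_energy_def)
next
  case (Suc L)
  let ?T = "tilt (\<beta> * (q - 1)) (gas_series q CARD('c) L (q * \<beta>))"
  have "prefix_sum q \<beta> (\<Union>a\<in>UNIV. (#) (a :: 'c) ` {u. length u = L}) [] (\<lambda>_. 1) I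
      = fact (card I) * (?T ^ CARD('c)) $ card I"
  proof (rule prefix_sum_children[OF _ Suc.prems _ finite_words])
    fix a :: 'c and J :: "nat set" assume "finite J"
    then show "prefix_sum q \<beta> ((#) a ` {u. length u = L}) [] (\<lambda>_. 1) J = fact (card J) * ?T $ card J"
      using prefix_sum_Cons[of J q \<beta> a _ "[]" "\<lambda>_. 1"] prefix_sum_const[of _ _ _ "[a]"] Suc.IH[of J]
      by simp
  qed simp
  then show ?case
    unfolding words_Suc prefix_sum_const[of _ _ _ s] by simp
qed

lemma prefix_sum_count_series:
  assumes "finite I"
  shows "prefix_sum q \<beta> {u :: 'c::finite list. length u = length s + j} s h I
    = fact (card I) * count_series q CARD('c) h j (length s) \<beta> $ card I"
  using assms
proof (induction s arbitrary: \<beta> I)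
  case Nil
  have "prefix_sum q \<beta> {u :: 'c list. length u = j} [] h I
      = h (card I) * prefix_sum q \<beta> {u :: 'c list. length u = j} [] (\<lambda>_. 1) I"
    by (simp add: prefix_sum_def sum_distrib_left mult_ac)
  then show ?case
    using Nil by (simp add: prefix_sum_gas_series)
next
  case (Cons a s)
  let ?W = "{u :: 'c list. length u = length s + j}" and ?k = "length s"
  let ?T = "tilt (\<beta> * (q - 1)) (gas_series q CARD('c) (?k + j) (q * \<beta>))"
  let ?C = "tilt (\<beta> * (q - 1)) (count_series q CARD('c) h j ?k (q * \<beta>))"
  have "{u :: 'c list. length u = length (a # s) + j} = (#) a ` ?W \<union> (\<Union>c\<in>- {a}. (#) c ` ?W)"
    by (auto simp: length_Suc_conv)
  then have "prefix_sum q \<beta> {u :: 'c list. length u = length (a # s) + j} (a # s) h I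
    = (\<Sum>J\<in>Pow I. prefix_sum q \<beta> ((#) a ` ?W) (a # s) h J
        * prefix_sum q \<beta> (\<Union>c\<in>- {a}. (#) c ` ?W) (a # s) (\<lambda>_. 1) (I - J))"
    using Cons.prems finite_words[where ?'c = 'c] by (auto intro!: prefix_sum_Un)
  also have "\<dots> = (\<Sum>J\<in>Pow I. (fact (card J) * ?C $ card J)
      * (fact (card (I - J)) * (?T ^ card (- {a})) $ card (I - J)))"
  proof (intro sum.cong refl arg_cong2[where f = "(*)"])
    fix J assume "J \<in> Pow I"
    then have J: "finite J" "finite (I - J)" using Cons.prems finite_subset by auto
    show "prefix_sum q \<beta> ((#) a ` ?W) (a # s) h J = fact (card J) * ?C $ card J"
      using J by (simp add: prefix_sum_Cons Cons.IH)
    show "prefix_sum q \<beta> (\<Union>c\<in>- {a}. (#) c ` ?W) (a # s) (\<lambda>_. 1) (I - J)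
        = fact (card (I - J)) * (?T ^ card (- {a})) $ card (I - J)"
      unfolding prefix_sum_const[of _ _ _ "a # s"]
    proof (rule prefix_sum_children[OF _ J(2) _ finite_words])
      fix c :: 'c and J :: "nat set" assume "finite J"
      then show "prefix_sum q \<beta> ((#) c ` ?W) [] (\<lambda>_. 1) J = fact (card J) * ?T $ card J"
        using prefix_sum_Cons[of J q \<beta> c _ "[]" "\<lambda>_. 1"] prefix_sum_const[of _ _ _ "[c]"]
        by (simp add: prefix_sum_gas_series)
    qed simp
  qed
  also have "\<dots> = fact (card I) * (?C * ?T ^ card (- {a})) $ card I"
    by (rule sum_Pow_fps_mult[OF Cons.prems])
  also have "card (- {a}) = CARD('c) - 1"
    by (simp add: Compl_eq_Diff_UNIV)
  finally show ?case by simp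
qed

unbundle no fps_syntax and vec_syntax

section \<open>Binary addresses of points\<close>

text \<open>The corner of a point of the unit cube tells in which child the point lies, and \<open>zoom c\<close> is the affine
  map from child \<open>c\<close> onto the unit cube. The address of a point lists the corners met while zooming in:
  its first $L$ letters determine the cube of level $L$ that contains the point.\<close>

definition corner :: "real ^ 'd \<Rightarrow> 'd \<Rightarrow> bool" where
  "corner x = (\<lambda>l. 1 / 2 \<le> x $ l)"

definition zoom :: "('d \<Rightarrow> bool) \<Rightarrow> real ^ 'd \<Rightarrow> real ^ 'd" where
  "zoom c x = (\<chi> l. 2 * x $ l - of_bool (c l))"

primrec address :: "nat \<Rightarrow> real ^ 'd \<Rightarrow> ('d \<Rightarrow> bool) list" where
  "address 0 x = []"
| "address (Suc L) x = corner x # address L (zoom (corner x) x)"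

primrec cube_index :: "('d \<Rightarrow> bool) list \<Rightarrow> 'd \<Rightarrow> nat" where
  "cube_index [] = (\<lambda>l. 0)"
| "cube_index (c # u) = (\<lambda>l. of_bool (c l) * 2 ^ length u + cube_index u l)"

abbreviation word_cube :: "('d \<Rightarrow> bool) list \<Rightarrow> (real ^ 'd) set" where
  "word_cube u \<equiv> dyadic_cube (length u) (cube_index u)"

lemma length_address [simp]: "length (address L x) = L"
  by (induction L arbitrary: x) auto

lemma take_address: "k \<le> L \<Longrightarrow> take k (address L x) = address k x"
proof (induction L arbitrary: k x)
  case (Suc L)
  then show ?case by (cases k) auto
qed simp

lemma cube_index_less: "cube_index u l < 2 ^ length u"
  by (induction u) (auto simp: of_bool_def)

lemma zoom_mem_unit_cube: "zoom c x \<in> unit_cube \<longleftrightarrow> x \<in> unit_cube \<and> corner x = c"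
proof -
  have "0 \<le> 2 * t - of_bool p \<and> 2 * t - of_bool p < 1 \<longleftrightarrow> (0 \<le> t \<and> t < 1) \<and> (1 / 2 \<le> t) = p"
    for p and t :: real
    by (cases p) auto
  then show ?thesis
    by (auto simp: zoom_def unit_cube_def corner_def fun_eq_iff)
qed

lemma zoom_mem_word_cube: "zoom c x \<in> word_cube u \<longleftrightarrow> x \<in> word_cube (c # u)"
proof -
  have "real i / 2 ^ k \<le> 2 * t - of_bool p \<and> 2 * t - of_bool p < (real i + 1) / 2 ^ k
    \<longleftrightarrow> real (of_bool p * 2 ^ k + i) / 2 ^ Suc k \<le> t \<and> t < (real (of_bool p * 2 ^ k + i) + 1) / 2 ^ Suc k"
    for i k p and t :: real
    by (cases p) (auto simp: field_simps)
  then show ?thesis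
    by (simp add: zoom_def dyadic_cube_def del: power_Suc)
qed

lemma mem_word_cube_iff: "x \<in> word_cube u \<longleftrightarrow> x \<in> unit_cube \<and> address (length u) x = u"
proof (induction u arbitrary: x)
  case Nil
  then show ?case by (simp add: dyadic_cube_def unit_cube_def)
next
  case (Cons c u)
  have "x \<in> word_cube (c # u) \<longleftrightarrow> zoom c x \<in> unit_cube \<and> address (length u) (zoom c x) = u"
    by (simp only: Cons flip: zoom_mem_word_cube)
  then show ?case by (auto simp: zoom_mem_unit_cube)
qed

lemma mem_dyadic_cube_iff:
  "length u = k \<Longrightarrow> x \<in> dyadic_cube k (cube_index u) \<longleftrightarrow> x \<in> unit_cube \<and> address k x = u"
  using mem_word_cube_iff[of x u] by auto

lemma dyadic_cube_index_unique:
  assumes "x \<in> dyadic_cube k i" "x \<in> dyadic_cube k j"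
  shows "i = j"
proof
  fix l
  have "real (i l) < real (j l) + 1" "real (j l) < real (i l) + 1"
    using assms by (auto simp: dyadic_cube_def field_simps dest!: spec[of _ l])
  then show "i l = j l" by linarith
qed

lemma dyadic_cubes_level_eq: "dyadic_cubes_level k = word_cube ` {u. length u = k}"
proof (intro set_eqI iffI)
  fix D :: "(real ^ 'd) set" assume "D \<in> dyadic_cubes_level k"
  then obtain i where D: "D = dyadic_cube k i" and i: "\<And>l. i l \<le> 2 ^ k - 1"
    by (auto simp: dyadic_cubes_level_def)
  define x :: "real ^ 'd" where "x = (\<chi> l. real (i l) / 2 ^ k)"
  have x: "x \<in> dyadic_cube k i"
    by (auto simp: x_def dyadic_cube_def divide_strict_right_mono)
  have "i l < 2 ^ k" for l
    using i[of l] one_le_power[of "2 :: nat" k] by linarith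
  then have "real (i l) < 2 ^ k" for l
    by (metis of_nat_less_numeral_power_cancel_iff)
  then have "x \<in> unit_cube"
    by (simp add: x_def unit_cube_def)
  then have "x \<in> word_cube (address k x)"
    unfolding mem_word_cube_iff by simp
  then have "cube_index (address k x) = i"
    using dyadic_cube_index_unique[OF x] by auto
  then show "D \<in> word_cube ` {u. length u = k}"
    unfolding D by (intro image_eqI[of _ _ "address k x"]) auto
next
  fix D :: "(real ^ 'd) set" assume "D \<in> word_cube ` {u. length u = k}"
  then obtain u where u: "D = dyadic_cube k (cube_index u)" "length u = k" by auto
  have "cube_index u l \<le> 2 ^ k - 1" for l
    using cube_index_less[of u l] u(2) by simp
  then show "D \<in> dyadic_cubes_level k"
    using u(1) by (auto simp: dyadic_cubes_level_def)
qed

lemma same_dyadic_cube_iff: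
  "same_dyadic_cube k x y \<longleftrightarrow> x \<in> unit_cube \<and> y \<in> unit_cube \<and> address k x = address k y"
proof
  assume "same_dyadic_cube k x y"
  then obtain u where "length u = k" "x \<in> word_cube u" "y \<in> word_cube u"
    by (auto simp: same_dyadic_cube_def dyadic_cubes_level_eq)
  then show "x \<in> unit_cube \<and> y \<in> unit_cube \<and> address k x = address k y"
    unfolding mem_word_cube_iff by auto
next
  assume "x \<in> unit_cube \<and> y \<in> unit_cube \<and> address k x = address k y"
  then have "x \<in> word_cube (address k x)" "y \<in> word_cube (address k x)"
    unfolding mem_word_cube_iff by auto
  moreover have "word_cube (address k x) \<in> dyadic_cubes_level k"
    unfolding dyadic_cubes_level_eq by (rule imageI) simp
  ultimately show "same_dyadic_cube k x y"
    unfolding same_dyadic_cube_def by blast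
qed

lemma address_separates:
  fixes x y :: "real ^ 'd"
  assumes "x \<in> unit_cube" "y \<in> unit_cube" "\<And>k. address k x = address k y"
  shows "x = y"
proof (rule vec_eq_iff[THEN iffD2], rule allI)
  fix l
  have "\<bar>x $ l - y $ l\<bar> \<le> (1 / 2) ^ k" for k
  proof -
    let ?i = "cube_index (address k x)"
    have "x \<in> dyadic_cube k ?i" "y \<in> dyadic_cube k ?i"
      using mem_word_cube_iff[of x "address k x"] mem_word_cube_iff[of y "address k x"] assms by auto
    then have "real (?i l) / 2 ^ k \<le> x $ l" "x $ l < (real (?i l) + 1) / 2 ^ k"
      "real (?i l) / 2 ^ k \<le> y $ l" "y $ l < (real (?i l) + 1) / 2 ^ k"
      by (auto simp: dyadic_cube_def)
    then show ?thesis
      by (simp add: add_divide_distrib power_divide abs_le_iff)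
  qed
  moreover have "(\<lambda>k. (1 / 2 :: real) ^ k) \<longlonglongrightarrow> 0"
    by (rule LIMSEQ_power_zero) simp
  ultimately have "\<bar>x $ l - y $ l\<bar> \<le> 0"
    by (intro LIMSEQ_le_const) auto
  then show "x $ l = y $ l" by simp
qed

text \<open>Two points share a cube of level $k$ exactly if their addresses agree in the first $k$ letters,
  hence the separation level is one more than the length of the common prefix.\<close>

lemma interaction_eq_address:
  fixes x y :: "real ^ 'd"
  assumes "x \<in> unit_cube" "y \<in> unit_cube" "x \<noteq> y" "separation_level x y \<le> L"
  shows "interaction x y
    = (2 ^ (CARD('d) - 2)) ^ length (longest_common_prefix (address L x) (address L y))"
proof -
  let ?s = "separation_level x y" and ?p = "longest_common_prefix (address L x) (address L y)"
  obtain k where "\<not> same_dyadic_cube k x y"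
    using address_separates[of x y] assms by (auto simp: same_dyadic_cube_iff)
  then have sep: "\<not> same_dyadic_cube ?s x y"
    unfolding separation_level_def by (rule LeastI)
  have below: "same_dyadic_cube k x y" if "k < ?s" for k
    using that unfolding separation_level_def by (metis not_less_Least)
  have "?s \<noteq> 0"
  proof
    assume "?s = 0"
    then have "address ?s x = address ?s y" by simp
    with sep assms show False by (simp add: same_dyadic_cube_iff)
  qed
  have agree: "address (length ?p) x = address (length ?p) y" "length ?p \<le> L"
  proof -
    have "prefix ?p (address L x)" "prefix ?p (address L y)"
      by (rule longest_common_prefix_prefix1 longest_common_prefix_prefix2)+
    then have "take (length ?p) (address L x) = ?p" "take (length ?p) (address L y) = ?p"
      by (metis append_eq_conv_conj prefix_def)+
    moreover have "length ?p \<le> L"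
      using prefix_length_le[OF \<open>prefix ?p (address L x)\<close>] by simp
    ultimately show "address (length ?p) x = address (length ?p) y" "length ?p \<le> L"
      by (simp_all add: take_address)
  qed
  have "length ?p < ?s"
  proof (rule ccontr)
    assume "\<not> length ?p < ?s"
    then have "address ?s x = address ?s y"
      using agree take_address[of ?s "length ?p"] by (metis not_less)
    then show False using sep assms by (simp add: same_dyadic_cube_iff)
  qed
  moreover have "?s - 1 \<le> length ?p"
  proof -
    have "address (?s - 1) x = address (?s - 1) y"
      using below[of "?s - 1"] \<open>?s \<noteq> 0\<close> by (simp add: same_dyadic_cube_iff)
    then have "take (?s - 1) (address L x) = take (?s - 1) (address L y)"
      using assms(4) by (simp add: take_address)
    then have "prefix (take (?s - 1) (address L x)) ?p"
      by (intro longest_common_prefix_max_prefix) (metis take_is_prefix)+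
    then show ?thesis
      using assms(4) by (auto dest: prefix_length_le)
  qed
  ultimately have "length ?p = ?s - 1" by simp
  then show ?thesis
    using assms(3) by (simp add: interaction_def power_mult)
qed

section \<open>Integrals over configurations\<close>

lemma emeasure_dyadic_cube:
  "emeasure lborel (dyadic_cube k i :: (real ^ 'd) set) = ennreal ((1 / 2 ^ CARD('d)) ^ k)"
proof (rule antisym)
  define a :: "real ^ 'd" where "a = (\<chi> l. real (i l) / 2 ^ k)"
  define e :: "real ^ 'd" where "e = (1 / 2 ^ k) *\<^sub>R \<Sum>Basis"
  have e_Basis: "e \<bullet> b = 1 / 2 ^ k" if "b \<in> Basis" for b
    using that by (simp add: e_def)
  have e_component: "e $ l = 1 / 2 ^ k" for l
    using e_Basis[of "axis l 1"] by (simp add: inner_axis)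
  have lo: "box a (a + e) \<subseteq> dyadic_cube k i" and hi: "dyadic_cube k i \<subseteq> cbox a (a + e)"
    by (auto simp: dyadic_cube_def mem_box_cart e_component a_def less_imp_le add_divide_distrib)
  have vol: "(\<Prod>b\<in>Basis. (a + e - a) \<bullet> b) = (1 / 2 ^ CARD('d)) ^ k"
    by (simp add: e_Basis power_divide flip: power_mult)
  have le: "a \<bullet> b \<le> (a + e) \<bullet> b" if "b \<in> Basis" for b
    using that by (simp add: inner_add_left e_Basis)
  have "emeasure lborel (box a (a + e)) = ennreal ((1 / 2 ^ CARD('d)) ^ k)"
    and "emeasure lborel (cbox a (a + e)) = ennreal ((1 / 2 ^ CARD('d)) ^ k)"
    using emeasure_lborel_box[of a "a + e"] emeasure_lborel_cbox[of a "a + e"] le unfolding vol by blast+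
  note boxes = this
  show "emeasure lborel (dyadic_cube k i :: (real ^ 'd) set) \<le> ennreal ((1 / 2 ^ CARD('d)) ^ k)"
    using emeasure_mono[OF hi, of lborel] unfolding boxes by simp
  show "ennreal ((1 / 2 ^ CARD('d)) ^ k) \<le> emeasure lborel (dyadic_cube k i :: (real ^ 'd) set)"
    using emeasure_mono[OF lo, of lborel] unfolding boxes by simp
qed

abbreviation unit_lebesgue :: "(real ^ 'd) measure" where
  "unit_lebesgue \<equiv> restrict_space lborel unit_cube"

lemma prob_space_unit_lebesgue: "prob_space (unit_lebesgue :: (real ^ 'd) measure)"
  by (intro prob_spaceI) (simp add: emeasure_restrict_space space_restrict_space emeasure_unit_cube)

lemma word_cube_measure:
  fixes u :: "('d::finite \<Rightarrow> bool) list"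
  shows "word_cube u \<in> sets unit_lebesgue"
    and "measure unit_lebesgue (word_cube u) = (1 / 2 ^ CARD('d)) ^ length u"
proof -
  have sub: "word_cube u \<subseteq> unit_cube"
    by (auto simp: mem_word_cube_iff)
  then show "word_cube u \<in> sets unit_lebesgue"
    by (subst sets_restrict_space_iff) auto
  have "emeasure unit_lebesgue (word_cube u) = ennreal ((1 / 2 ^ CARD('d)) ^ length u)"
    using sub by (subst emeasure_restrict_space) (auto simp: emeasure_dyadic_cube)
  then show "measure unit_lebesgue (word_cube u) = (1 / 2 ^ CARD('d)) ^ length u"
    by (simp add: measure_def)
qed

lemma space_cube_lebesgue: "space (cube_lebesgue n) = PiE {..<n} (\<lambda>_. unit_cube)"
  by (simp add: cube_lebesgue_def space_PiM space_restrict_space)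

lemma measure_cube_lebesgue_PiE:
  fixes X :: "nat \<Rightarrow> (real ^ 'd) set"
  assumes "\<And>i. i < n \<Longrightarrow> X i \<in> sets unit_lebesgue"
  shows "PiE {..<n} X \<in> sets (cube_lebesgue n)"
    and "measure (cube_lebesgue n) (PiE {..<n} X) = (\<Prod>i<n. measure unit_lebesgue (X i))"
proof -
  interpret finite_product_prob_space "\<lambda>_ :: nat. unit_lebesgue :: (real ^ 'd) measure" "{..<n}"
    by (intro finite_product_prob_space.intro product_prob_spaceI prob_space_unit_lebesgue
        finite_product_sigma_finite.intro finite_product_sigma_finite_axioms.intro
        prob_space_imp_sigma_finite product_sigma_finite.intro) auto
  show "PiE {..<n} X \<in> sets (cube_lebesgue n)"
    unfolding cube_lebesgue_def using assms by (intro sets_PiM_I_finite) auto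
  show "measure (cube_lebesgue n) (PiE {..<n} X) = (\<Prod>i<n. measure unit_lebesgue (X i))"
    unfolding cube_lebesgue_def using assms by (intro prob_times) auto
qed

definition addresses :: "nat \<Rightarrow> nat \<Rightarrow> (nat \<Rightarrow> real ^ 'd) \<Rightarrow> nat \<Rightarrow> ('d \<Rightarrow> bool) list" where
  "addresses n L x = restrict (\<lambda>i. address L (x i)) {..<n}"

text \<open>A function of the addresses is a step function, constant on products of cubes of level $L$. This
  yields both its measurability and its integral.\<close>

lemma addresses_expand:
  fixes x :: "nat \<Rightarrow> real ^ 'd::finite"
  assumes x: "x \<in> space (cube_lebesgue n)"
  shows "F (addresses n L x) =
    (\<Sum>u\<in>PiE {..<n} (\<lambda>_. {u. length u = L}). F u * indicator (PiE {..<n} (\<lambda>i. word_cube (u i))) x :: real)"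
proof -
  let ?W = "PiE {..<n} (\<lambda>_. {u :: ('d \<Rightarrow> bool) list. length u = L})"
  have fin: "finite ?W"
    by (intro finite_PiE finite_words) auto
  have mem: "x \<in> PiE {..<n} (\<lambda>i. word_cube (u i)) \<longleftrightarrow> u = addresses n L x" if "u \<in> ?W" for u
  proof -
    have len: "length (u i) = L" if "i < n" for i
      using PiE_mem[OF \<open>u \<in> ?W\<close>] that by auto
    have "x \<in> PiE {..<n} (\<lambda>i. word_cube (u i)) \<longleftrightarrow> (\<forall>i<n. x i \<in> word_cube (u i))"
      using x by (auto simp: space_cube_lebesgue PiE_iff)
    also have "\<dots> \<longleftrightarrow> (\<forall>i<n. address L (x i) = u i)"
      using x len by (auto simp: mem_dyadic_cube_iff space_cube_lebesgue PiE_iff)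
    also have "\<dots> \<longleftrightarrow> u = addresses n L x"
      using that by (auto simp: addresses_def fun_eq_iff PiE_iff extensional_def)
    finally show ?thesis .
  qed
  have "(\<Sum>u\<in>?W. F u * indicator (PiE {..<n} (\<lambda>i. word_cube (u i))) x)
      = (\<Sum>u\<in>?W. if u = addresses n L x then F u else 0)"
    by (intro sum.cong refl) (simp add: mem indicator_def)
  also have "\<dots> = F (addresses n L x)"
    using fin by (auto simp: addresses_def)
  finally show ?thesis ..
qed

lemma
  fixes F :: "(nat \<Rightarrow> ('d::finite \<Rightarrow> bool) list) \<Rightarrow> real"
  shows measurable_addresses: "(\<lambda>x. F (addresses n L x)) \<in> borel_measurable (cube_lebesgue n)"
    and integral_addresses: "(\<integral>x. F (addresses n L x) \<partial>cube_lebesgue n) =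
      ((1 / 2 ^ CARD('d)) ^ L) ^ n * (\<Sum>u\<in>PiE {..<n} (\<lambda>_. {u. length u = L}). F u)"
proof -
  let ?M = "cube_lebesgue n :: (nat \<Rightarrow> real ^ 'd) measure"
  let ?W = "PiE {..<n} (\<lambda>_. {u :: ('d \<Rightarrow> bool) list. length u = L})"
  let ?B = "\<lambda>u. PiE {..<n} (\<lambda>i. word_cube (u i) :: (real ^ 'd) set)"
  interpret prob_space ?M by (rule prob_space_cube_lebesgue)
  have sets: "?B u \<in> sets ?M" for u
    by (intro measure_cube_lebesgue_PiE word_cube_measure)
  have prob: "prob (?B u) = ((1 / 2 ^ CARD('d)) ^ L) ^ n" if "u \<in> ?W" for u
  proof -
    have "prob (?B u) = (\<Prod>i<n. measure unit_lebesgue (word_cube (u i) :: (real ^ 'd) set))"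
      by (intro measure_cube_lebesgue_PiE word_cube_measure)
    also have "\<dots> = (\<Prod>i<n. (1 / 2 ^ CARD('d)) ^ L)"
      using PiE_mem[OF that] by (intro prod.cong refl) (auto simp only: word_cube_measure)
    finally show ?thesis by simp
  qed
  show "(\<lambda>x. F (addresses n L x)) \<in> borel_measurable ?M"
    by (subst measurable_cong[OF addresses_expand]) (use sets in auto)
  have "(\<integral>x. F (addresses n L x) \<partial>?M) = (\<integral>x. (\<Sum>u\<in>?W. F u * indicator (?B u) x) \<partial>?M)"
    by (rule Bochner_Integration.integral_cong[OF refl addresses_expand])
  also have "\<dots> = (\<Sum>u\<in>?W. F u * prob (?B u))"
  proof -
    have "integrable ?M (indicator (?B u) :: _ \<Rightarrow> real)" for u
      using sets by (simp add: integrable_indicator_iff emeasure_eq_measure)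
    then show ?thesis
      using sets by (subst Bochner_Integration.integral_sum) auto
  qed
  also have "\<dots> = ((1 / 2 ^ CARD('d)) ^ L) ^ n * (\<Sum>u\<in>?W. F u)"
    unfolding sum_distrib_left by (intro sum.cong refl) (simp only: prob mult.commute)
  finally show "(\<integral>x. F (addresses n L x) \<partial>?M) = ((1 / 2 ^ CARD('d)) ^ L) ^ n * (\<Sum>u\<in>?W. F u)" .
qed

text \<open>Coinciding points lie in a common cube of level $L$. There are $b^L$ such cubes, and each contains two
  given points with probability $b^{-2L}$.\<close>

lemma prob_coincide_le:
  assumes "i < n" "j < n" "i \<noteq> j"
  shows "measure (cube_lebesgue n) {x \<in> space (cube_lebesgue n). (x i :: real ^ 'd::finite) = x j}
    \<le> (1 / 2 ^ CARD('d)) ^ L"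
proof -
  let ?M = "cube_lebesgue n :: (nat \<Rightarrow> real ^ 'd) measure"
  let ?p = "(1 / 2 ^ CARD('d)) ^ L :: real"
  let ?W = "{u :: ('d \<Rightarrow> bool) list. length u = L}"
  define X :: "('d \<Rightarrow> bool) list \<Rightarrow> nat \<Rightarrow> (real ^ 'd) set"
    where "X u l = (if l \<in> {i, j} then word_cube u else unit_cube)" for u l
  interpret prob_space ?M by (rule prob_space_cube_lebesgue)
  have unit: "measure unit_lebesgue (unit_cube :: (real ^ 'd) set) = 1"
      "(unit_cube :: (real ^ 'd) set) \<in> sets unit_lebesgue"
    using prob_space.prob_space[OF prob_space_unit_lebesgue] sets.top[of unit_lebesgue]
    by (simp_all add: space_restrict_space)
  have X: "X u l \<in> sets unit_lebesgue" for u l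
    using unit by (simp add: X_def word_cube_measure)
  have prob: "prob (PiE {..<n} (X u)) = ?p ^ 2" if "u \<in> ?W" for u
  proof -
    have "prob (PiE {..<n} (X u)) = (\<Prod>l<n. measure unit_lebesgue (X u l))"
      by (intro measure_cube_lebesgue_PiE X)
    also have "\<dots> = (\<Prod>l\<in>{i, j}. measure unit_lebesgue (X u l))"
      using assms unit by (intro prod.mono_neutral_right) (auto simp: X_def)
    also have "\<dots> = ?p ^ 2"
      using assms that word_cube_measure(2)[of u] by (simp add: X_def power2_eq_square)
    finally show ?thesis .
  qed
  have cover: "{x \<in> space ?M. x i = x j} \<subseteq> (\<Union>u\<in>?W. PiE {..<n} (X u))"
  proof
    fix x assume "x \<in> {x \<in> space ?M. x i = x j}"
    then have x: "x \<in> PiE {..<n} (\<lambda>_. unit_cube)" "x i = x j"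
      by (auto simp: space_cube_lebesgue)
    then have "x \<in> PiE {..<n} (X (address L (x i)))"
      using mem_word_cube_iff[of "x i" "address L (x i)"] assms
      by (auto simp: X_def PiE_iff)
    then show "x \<in> (\<Union>u\<in>?W. PiE {..<n} (X u))"
      by (intro UN_I[of "address L (x i)"]) auto
  qed
  have sets: "PiE {..<n} (X u) \<in> sets ?M" for u
    by (intro measure_cube_lebesgue_PiE X)
  have "prob {x \<in> space ?M. x i = x j} \<le> prob (\<Union>u\<in>?W. PiE {..<n} (X u))"
    using sets by (intro finite_measure_mono cover sets.finite_UN finite_words) auto
  also have "\<dots> \<le> (\<Sum>u\<in>?W. prob (PiE {..<n} (X u)))"
    using sets by (intro finite_measure_subadditive_finite finite_words) auto
  also have "\<dots> = real (card ?W) * ?p ^ 2"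
    using prob by simp
  also have "card ?W = (2 ^ CARD('d)) ^ L"
    using card_lists_length_eq[of "UNIV :: ('d \<Rightarrow> bool) set" L] by (simp add: card_fun)
  finally show ?thesis
    by (simp add: power2_eq_square power_divide)
qed

lemma AE_distinct:
  "AE x in (cube_lebesgue n :: (nat \<Rightarrow> real ^ 'd::finite) measure). \<forall>i<n. \<forall>j<n. i \<noteq> j \<longrightarrow> x i \<noteq> x j"
proof -
  let ?M = "cube_lebesgue n :: (nat \<Rightarrow> real ^ 'd) measure"
  interpret prob_space ?M by (rule prob_space_cube_lebesgue)
  have "AE x in ?M. x i \<noteq> x j" if ij: "i < n" "j < n" "i \<noteq> j" for i j
  proof -
    have [measurable]: "(\<lambda>x. x i) \<in> ?M \<rightarrow>\<^sub>M borel" "(\<lambda>x. x j) \<in> ?M \<rightarrow>\<^sub>M borel"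
      using ij by (auto intro: measurable_component_cube_lebesgue)
    have sets: "{x \<in> space ?M. x i = x j} \<in> sets ?M"
      by measurable
    have "(1 / 2 ^ CARD('d) :: real) < 1"
      by (simp add: one_less_power)
    then have "(\<lambda>L. (1 / 2 ^ CARD('d) :: real) ^ L) \<longlonglongrightarrow> 0"
      by (intro LIMSEQ_power_zero) simp
    then have "prob {x \<in> space ?M. x i = x j} \<le> 0"
      using prob_coincide_le[OF ij] by (intro LIMSEQ_le_const) auto
    then have "prob {x \<in> space ?M. x i = x j} = 0"
      by (simp add: antisym)
    then have "{x \<in> space ?M. x i = x j} \<in> null_sets ?M"
      using sets by (simp add: null_sets_def emeasure_eq_measure)
    then show ?thesis
      by (rule AE_I') auto
  qed
  then show ?thesis
    by (intro AE_all_countable[THEN iffD2] allI) (simp add: AE_all_countable)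
qed

lemma excess_energy_addresses_eventually:
  fixes x :: "nat \<Rightarrow> real ^ 'd::finite"
  assumes x: "x \<in> space (cube_lebesgue n)" and distinct: "\<forall>i<n. \<forall>j<n. i \<noteq> j \<longrightarrow> x i \<noteq> x j"
  shows "\<forall>\<^sub>F L in sequentially. excess_energy (2 ^ (CARD('d) - 2)) {..<n} (addresses n L x)
    = energy n x - real n * (real n - 1)"
proof -
  let ?q = "2 ^ (CARD('d) - 2) :: real"
  have "\<forall>\<^sub>F L in sequentially. \<forall>i\<in>{..<n}. \<forall>j\<in>{..<n}. separation_level (x i) (x j) \<le> L"
    by (simp add: eventually_ball_finite_distrib eventually_ge_at_top)
  then show ?thesis
  proof eventually_elim
    case (elim L)
    have "excess_energy ?q {..<n} (addresses n L x) = (\<Sum>i<n. \<Sum>j\<in>{..<n} - {i}. interaction (x i) (x j) - 1)"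
      unfolding excess_energy_def
    proof (intro sum.cong refl)
      fix i j assume ij: "i \<in> {..<n}" "j \<in> {..<n} - {i}"
      then have "x i \<in> unit_cube" "x j \<in> unit_cube"
        using x by (auto simp: space_cube_lebesgue PiE_iff)
      then show "?q ^ length (longest_common_prefix (addresses n L x i) (addresses n L x j)) - 1
          = interaction (x i) (x j) - 1"
        using ij elim distinct by (subst interaction_eq_address) (auto simp: addresses_def)
    qed
    also have "\<dots> = energy n x - (\<Sum>i<n. real n - 1)"
      unfolding energy_def sum_subtractf[symmetric]
      by (intro sum.cong refl) (simp add: sum_subtractf card_Diff_singleton of_nat_diff)
    finally show ?case by simp
  qed
qed

text \<open>The left-hand side is the integral for the interaction capped at depth $|s| + j$. For distinct points
  the cap has no effect once it exceeds all separation levels.\<close>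

lemma gas_integral_limit:
  fixes s :: "('d::finite \<Rightarrow> bool) list" and h :: "nat \<Rightarrow> real"
  assumes "0 < \<beta>"
  defines "q \<equiv> 2 ^ (CARD('d) - 2)" and "D \<equiv> word_cube s"
  shows "(\<lambda>j. ((1 / 2 ^ CARD('d)) ^ (length s + j)) ^ n * fact n
        * fps_nth (count_series q (2 ^ CARD('d)) h j (length s) \<beta>) n)
      \<longlonglongrightarrow> (\<integral>x. exp (- \<beta> * (energy n x - real n * (real n - 1))) * h (card {i. i < n \<and> x i \<in> D})
          \<partial>cube_lebesgue n)"
proof -
  let ?M = "cube_lebesgue n :: (nat \<Rightarrow> real ^ 'd) measure"
  interpret prob_space ?M by (rule prob_space_cube_lebesgue)
  define F :: "(nat \<Rightarrow> ('d \<Rightarrow> bool) list) \<Rightarrow> real" where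
    "F u = exp (- \<beta> * excess_energy q {..<n} u) * h (card {i\<in>{..<n}. prefix s (u i)})" for u
  have sum: "((1 / 2 ^ CARD('d)) ^ (length s + j)) ^ n * fact n
        * fps_nth (count_series q (2 ^ CARD('d)) h j (length s) \<beta>) n
      = (\<integral>x. F (addresses n (length s + j) x) \<partial>?M)" for j
  proof -
    have "(\<Sum>u\<in>PiE {..<n} (\<lambda>_. {u. length u = length s + j}). F u)
        = fact n * fps_nth (count_series q (2 ^ CARD('d)) h j (length s) \<beta>) n"
      using prefix_sum_count_series[of "{..<n}" q \<beta> s j h]
      by (simp add: F_def prefix_sum_def card_fun)
    then show ?thesis
      unfolding integral_addresses by simp
  qed
  have count: "{i. i < n \<and> x i \<in> D} = {i\<in>{..<n}. prefix s (addresses n (length s + j) x i)}"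
    if "x \<in> space ?M" for x j
  proof -
    have "x i \<in> D \<longleftrightarrow> prefix s (address (length s + j) (x i))" if "i < n" for i
    proof -
      have "x i \<in> unit_cube"
        using \<open>x \<in> space ?M\<close> that by (auto simp: space_cube_lebesgue PiE_iff)
      then have "x i \<in> D \<longleftrightarrow> take (length s) (address (length s + j) (x i)) = s"
        unfolding D_def mem_word_cube_iff by (simp add: take_address)
      also have "\<dots> \<longleftrightarrow> prefix s (address (length s + j) (x i))"
        by (metis append_eq_conv_conj prefix_def take_is_prefix)
      finally show ?thesis .
    qed
    then show ?thesis by (auto simp: addresses_def)
  qed
  show ?thesis
    unfolding sum
  proof (rule integral_dominated_convergence[where w = "\<lambda>_. \<Sum>m\<le>n. \<bar>h m\<bar>"])
    show "(\<lambda>x. F (addresses n (length s + j) x)) \<in> borel_measurable ?M" for j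
      by (rule measurable_addresses)
    have "(\<lambda>x. h (card {i. i < n \<and> x i \<in> D})) \<in> borel_measurable ?M"
    proof -
      have "(\<lambda>x. h (card {i\<in>{..<n}. prefix s (addresses n (length s + 0) x i)})) \<in> borel_measurable ?M"
        by (rule measurable_addresses)
      then show ?thesis
        by (rule measurable_cong[THEN iffD1, rotated]) (simp only: count[of _ 0])
    qed
    note h = this
    show "(\<lambda>x. exp (- \<beta> * (energy n x - real n * (real n - 1))) * h (card {i. i < n \<and> x i \<in> D}))
        \<in> borel_measurable ?M"
      by (rule borel_measurable_times[OF _ h]) measurable
    show "AE x in ?M. (\<lambda>j. F (addresses n (length s + j) x))
        \<longlonglongrightarrow> exp (- \<beta> * (energy n x - real n * (real n - 1))) * h (card {i. i < n \<and> x i \<in> D})"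
      using AE_distinct AE_space
    proof eventually_elim
      case (elim x)
      from excess_energy_addresses_eventually[OF elim(2,1)]
      have "\<forall>\<^sub>F j in sequentially. excess_energy q {..<n} (addresses n (j + length s) x)
          = energy n x - real n * (real n - 1)"
        unfolding q_def by (rule eventually_sequentially_seg[THEN iffD2])
      then show ?case
        unfolding F_def count[OF elim(2), symmetric]
        by (intro tendsto_eventually) (auto elim!: eventually_mono simp: add.commute)
    qed
    show "AE x in ?M. norm (F (addresses n (length s + j) x)) \<le> (\<Sum>m\<le>n. \<bar>h m\<bar>)" for j
    proof (rule AE_I2)
      fix x
      let ?N = "card {i\<in>{..<n}. prefix s (addresses n (length s + j) x i)}"
      have "?N \<le> card {..<n}"
        by (intro card_mono) auto
      then have "\<bar>h ?N\<bar> \<le> (\<Sum>m\<le>n. \<bar>h m\<bar>)"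
        by (intro member_le_sum) auto
      moreover have "exp (- \<beta> * excess_energy q {..<n} (addresses n (length s + j) x)) \<le> 1"
      proof -
        have "0 \<le> excess_energy q {..<n} u" for u :: "nat \<Rightarrow> ('d \<Rightarrow> bool) list"
          unfolding excess_energy_def q_def by (intro sum_nonneg) auto
        then show ?thesis using assms(1) by simp
      qed
      ultimately show "norm (F (addresses n (length s + j) x)) \<le> (\<Sum>m\<le>n. \<bar>h m\<bar>)"
        using mult_mono[of _ 1 "\<bar>h ?N\<bar>" "\<Sum>m\<le>n. \<bar>h m\<bar>"] by (simp add: F_def abs_mult)
    qed
  qed simp
qed

section \<open>The variance of point counts\<close>

text \<open>The bounds on the first two moments hold for the capped gas in a form that is linear in the
  unnormalized integrals, and so pass to the limit.\<close>

lemma variance_count_le: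
  fixes s :: "('d::finite \<Rightarrow> bool) list"
  assumes "CARD('d) \<ge> 3" "0 < \<beta>"
  shows "prob_space.variance (coulomb_gas n \<beta>) (num_points n (word_cube s)) \<le> 2 * tail_moment \<beta>"
proof -
  let ?M = "cube_lebesgue n :: (nat \<Rightarrow> real ^ 'd) measure"
  let ?G = "coulomb_gas n \<beta> :: (nat \<Rightarrow> real ^ 'd) measure"
  let ?D = "word_cube s"
  define q :: real where "q = 2 ^ (CARD('d) - 2)"
  define b :: nat where "b = 2 ^ CARD('d)"
  define J where "J h = (\<integral>x. exp (- \<beta> * (energy n x - real n * (real n - 1)))
    * h (card {i. i < n \<and> x i \<in> ?D}) \<partial>?M)" for h :: "nat \<Rightarrow> real"
  define A where "A h j = ((1 / 2 ^ CARD('d)) ^ (length s + j)) ^ n * fact n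
        * fps_nth (count_series q b h j (length s) \<beta>) n" for h j
  define \<mu> where "\<mu> = real n / real b ^ length s"
  have q: "2 \<le> q"
    using power_increasing[of 1 "CARD('d) - 2" "2 :: real"] assms(1) by (simp add: q_def)
  have b: "2 \<le> b"
    using power_increasing[of 1 "CARD('d)" "2 :: nat"] assms(1) by (simp add: b_def)
  have lim: "A h \<longlonglongrightarrow> J h" for h
    unfolding A_def J_def q_def b_def using gas_integral_limit[OF assms(2), of s n h] by simp
  have A1: "A (\<lambda>_. 1) j = ((1 / 2 ^ CARD('d)) ^ (length s + j)) ^ n * fact n
        * fps_nth (gas_series q b (length s + j) \<beta>) n" for j
    using b by (simp add: A_def count_series_const)
  have J1: "J real = \<mu> * J (\<lambda>_. 1)"
  proof (rule LIMSEQ_unique[OF lim])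
    have "A real = (\<lambda>j. \<mu> * A (\<lambda>_. 1) j)"
      using b by (simp add: A1 fun_eq_iff \<mu>_def) (simp add: A_def count_series_first_moment)
    then show "A real \<longlonglongrightarrow> \<mu> * J (\<lambda>_. 1)"
      by (simp only: tendsto_mult_left lim)
  qed
  have J2: "J (\<lambda>m. real m ^ 2) \<le> (2 * tail_moment \<beta> + \<mu> ^ 2) * J (\<lambda>_. 1)"
  proof (rule LIMSEQ_le[OF lim tendsto_mult_left[OF lim]], intro exI allI impI)
    fix j
    let ?c = "((1 / 2 ^ CARD('d)) ^ (length s + j)) ^ n * fact n :: real"
    let ?S = "fps_nth (gas_series q b (length s + j) \<beta>) n"
    have "0 \<le> ?S"
      using q assms by (intro log_concave_nonneg log_concave_gas_series) auto
    have "fps_nth (count_series q b (\<lambda>m. real m ^ 2) j (length s) \<beta>) n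
        \<le> (2 * tail_moment \<beta> * (1 - 1 / 2 ^ length s) + \<mu> ^ 2) * ?S"
      unfolding \<mu>_def using q b assms by (intro count_series_second_moment) auto
    also have "\<dots> \<le> (2 * tail_moment \<beta> + \<mu> ^ 2) * ?S"
      using tail_moment_nonneg[OF assms(2)] \<open>0 \<le> ?S\<close>
      by (intro mult_right_mono add_right_mono mult_left_le) auto
    finally have "?c * fps_nth (count_series q b (\<lambda>m. real m ^ 2) j (length s) \<beta>) n
        \<le> ?c * ((2 * tail_moment \<beta> + \<mu> ^ 2) * ?S)"
      by (intro mult_left_mono) auto
    then show "A (\<lambda>m. real m ^ 2) j \<le> (2 * tail_moment \<beta> + \<mu> ^ 2) * A (\<lambda>_. 1) j"
      unfolding A1 by (simp add: A_def mult_ac)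
  qed
  interpret G: prob_space ?G
    by (rule prob_space_coulomb_gas[OF assms(2)])
  define Z where "Z = partition_fun TYPE('d) n \<beta>"
  have "0 < Z"
    unfolding Z_def by (rule partition_fun_pos[OF assms(2)])
  \<comment> \<open>The factor that separates \<open>J\<close> from an expectation: the removed constant energy and the normalization.\<close>
  define c where "c = exp (- \<beta> * (real n * (real n - 1))) / Z"
  have "word_cube s \<in> dyadic_cubes"
    by (auto simp: dyadic_cubes_def dyadic_cubes_level_eq)
  note meas = measurable_num_points[OF this]
  have E: "G.expectation (\<lambda>x. g (num_points n ?D x)) = c * J (\<lambda>m. g (real m))"
    if [measurable]: "g \<in> borel_measurable borel" for g :: "real \<Rightarrow> real"
  proof -
    have [measurable]: "num_points n ?D \<in> borel_measurable ?M"
      using meas[of n \<beta>] by (simp add: coulomb_gas_def cong: measurable_cong_sets)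
    have "G.expectation (\<lambda>x. g (num_points n ?D x))
        = (\<integral>x. (exp (- \<beta> * energy n x) / Z) *\<^sub>R g (num_points n ?D x) \<partial>?M)"
      unfolding coulomb_gas_def Z_def[symmetric] using \<open>0 < Z\<close>
      by (intro integral_density) auto
    also have "\<dots> = (\<integral>x. c * (exp (- \<beta> * (energy n x - real n * (real n - 1)))
        * g (real (card {i. i < n \<and> x i \<in> ?D}))) \<partial>?M)"
    proof -
      have "exp (- \<beta> * e) / Z = c * exp (- \<beta> * (e - real n * (real n - 1)))" for e
        by (simp add: c_def algebra_simps flip: exp_add)
      then show ?thesis
        by (simp only: num_points_def real_scaleR_def mult.assoc)
    qed
    finally show ?thesis
      by (simp add: J_def)
  qed
  have norm: "c * J (\<lambda>_. 1) = 1"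
    using E[of "\<lambda>_. 1"] G.prob_space by simp
  have mean: "G.expectation (num_points n ?D) = \<mu>"
    using E[of "\<lambda>x. x"] norm by (simp add: J1)
  have "G.expectation (\<lambda>x. num_points n ?D x ^ 2) = c * J (\<lambda>m. real m ^ 2)"
    by (rule E) simp
  also have "\<dots> \<le> c * ((2 * tail_moment \<beta> + \<mu> ^ 2) * J (\<lambda>_. 1))"
    using J2 \<open>0 < Z\<close> by (intro mult_left_mono) (auto simp: c_def)
  also have "\<dots> = 2 * tail_moment \<beta> + \<mu> ^ 2"
    using norm by (simp add: mult.left_commute)
  finally have second: "G.expectation (\<lambda>x. num_points n ?D x ^ 2) \<le> 2 * tail_moment \<beta> + \<mu> ^ 2" .
  have bounded: "num_points n ?D x \<le> real n" for x
    using card_mono[of "{..<n}" "{i. i < n \<and> x i \<in> ?D}"] by (auto simp: num_points_def)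
  have "G.variance (num_points n ?D) = G.expectation (\<lambda>x. num_points n ?D x ^ 2) - \<mu> ^ 2"
  proof (subst G.variance_eq)
    have nonneg: "0 \<le> num_points n ?D x" for x
      by (simp add: num_points_def)
    show "integrable ?G (num_points n ?D)"
      using bounded nonneg meas[of n \<beta>]
      by (intro G.integrable_const_bound[where B = "real n"] AE_I2) simp_all
    show "integrable ?G (\<lambda>x. num_points n ?D x ^ 2)"
      using power_mono[OF bounded nonneg, where n = 2] meas[of n \<beta>]
      by (intro G.integrable_const_bound[where B = "real n ^ 2"] AE_I2 borel_measurable_power) simp_all
  qed (simp add: mean)
  then show ?thesis
    using second by simp
qed

theorem theorem2:
  assumes "CARD('d::finite) \<ge> 3"
  shows "\<exists>K :: real \<Rightarrow> real. antimono_on {0<..} K \<and>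
    (\<forall>n \<ge> 1. \<forall>\<beta> > 0.
      (\<forall>D \<in> (dyadic_cubes_level 1 :: (real ^ 'd) set set).
        prob_space.variance (coulomb_gas n \<beta>) (num_points n D) \<le> K \<beta> * max ((ln (real n)) ^ 12) 1) \<and>
      (\<forall>D \<in> (dyadic_cubes :: (real ^ 'd) set set).
        prob_space.variance (coulomb_gas n \<beta>) (num_points n D) \<le> K \<beta> * max ((ln (real n)) ^ 12) 1))"
proof (intro exI[of _ "\<lambda>\<beta>. 2 * tail_moment \<beta>"] conjI allI impI ballI)
  show "antimono_on {0<..} (\<lambda>\<beta>. 2 * tail_moment \<beta>)"
    using tail_moment_antimono by (auto simp: monotone_on_def)
  have bound: "prob_space.variance (coulomb_gas n \<beta>) (num_points n D)
      \<le> 2 * tail_moment \<beta> * max ((ln (real n)) ^ 12) 1"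
    if "D \<in> dyadic_cubes" "0 < \<beta>" for D :: "(real ^ 'd) set" and n \<beta>
  proof -
    obtain s where s: "D = word_cube s"
      using \<open>D \<in> dyadic_cubes\<close> unfolding dyadic_cubes_def dyadic_cubes_level_eq by blast
    have "prob_space.variance (coulomb_gas n \<beta>) (num_points n D) \<le> 2 * tail_moment \<beta> * 1"
      unfolding s using variance_count_le[OF assms that(2)] by simp
    also have "\<dots> \<le> 2 * tail_moment \<beta> * max ((ln (real n)) ^ 12) 1"
      using tail_moment_nonneg[OF that(2)] by (intro mult_left_mono) auto
    finally show ?thesis .
  qed
  fix n :: nat and \<beta> :: real and D :: "(real ^ 'd) set"
  assume "0 < \<beta>"
  show "prob_space.variance (coulomb_gas n \<beta>) (num_points n D) \<le> 2 * tail_moment \<beta> * max ((ln (real n)) ^ 12) 1"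
    if "D \<in> dyadic_cubes_level 1"
    using that \<open>0 < \<beta>\<close> by (intro bound) (auto simp: dyadic_cubes_def)
  show "prob_space.variance (coulomb_gas n \<beta>) (num_points n D) \<le> 2 * tail_moment \<beta> * max ((ln (real n)) ^ 12) 1"
    if "D \<in> dyadic_cubes"
    using that \<open>0 < \<beta>\<close> by (intro bound)
qed

end
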